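(* The value function $\phi(\Lambda)=\min_{\mu\in\mathbb{R}^d}\lVert J(\Lambda,\mu)\rVert$ is locally Lipschitz on $\mathcal F=\{\Lambda\in\mathbb{R}^m:A(\Lambda)\text{ is Hurwitz}\}$. Consequently, $\phi$ attains a global minimum $\phi_B$ on every admissible gain box $B$. If $\phi_B>0$, then $\rho^\star=1/\phi$ attains its maximum over $B$ at exactly the same gains. If $\phi_B=0$, an optimizing pair $(\Lambda,\mu)\in B\times\mathbb{R}^d$ (that is, $\lVert J(\Lambda,\mu)\rVert=\phi_B$) satisfies $J(\Lambda,\mu)=0$, and the corresponding quadratic Lyapunov function $V(\mathbf w)=\mathbf w^{\top}P(\Lambda)\mathbf w$ is global for $\dot{\mathbf w}=\mathbf F_\Lambda(\mathbf w)$.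
   Context: Polynomial system: $\dot{\mathbf x}=\mathbf p(\mathbf x)$ with $\mathbf p\in\mathbb{R}[\mathbf x]^n$, $\mathbf p(\mathbf 0)=\mathbf 0$, and the standing assumption that the Jacobian $J_x(\mathbf p)|_{\mathbf 0}$ is Hurwitz (all eigenvalues have negative real part). $\lVert\cdot\rVert$ is the spectral norm. Fixed lift: $m\ge0$, $N=n+m$, $\mathbf g=(g_1,\dots,g_m)$ with each $g_i$ a monomial in $\mathbf x$ of degree at least $2$; $\Phi(\mathbf x)=(\mathbf x,\mathbf g(\mathbf x))\in\mathbb{R}^N$; coordinates $\mathbf w=(\mathbf x,\mathbf y)$. The lift is inner-quadratic: for each $i$ a factorization $g_i=a_ib_i$ is fixed, with $a_i,b_i\in\{x_1,\dots,x_n,y_1,\dots,y_{i-1}\}$ (the identity holding after substituting $\mathbf y=\mathbf g(\mathbf x)$). Stabilizers: $h_i=y_i-a_ib_i$. Reference extension: $\mathbf F_0(\mathbf w)=A_0\mathbf w+H_0(\mathbf w\otimes\mathbf w)$, a vector field on $\mathbb{R}^N$ with polynomial components of total degree at most two, satisfying $\mathbf F_0(\Phi(\mathbf x))=J_x(\Phi)(\mathbf x)\mathbf p(\mathbf x)$ for all $\mathbf x$. Stabilized family: for $\Lambda\in\mathbb{R}^m$, $\mathbf F_\Lambda=\mathbf F_0-\sum_i\lambda_i\mathbf e_{n+i}h_i=A(\Lambda)\mathbf w+H(\Lambda)(\mathbf w\otimes\mathbf w)$ with $A(\Lambda)=A_0-\sum_i\lambda_i\mathbf e_{n+i}\mathbf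 e_{n+i}^{\top}$, $H(\Lambda)=H_0+\sum_i\lambda_i\mathbf e_{n+i}s_i^{\top}$, where $s_i\in\mathbb{R}^{N^2}$ satisfies $s_i^{\top}(\mathbf w\otimes\mathbf w)=a_ib_i$. Gauge: let $\mathcal K=\{K\in\mathbb{R}^{N\times N^2}:K(\mathbf w\otimes\mathbf w)=0\ \forall\mathbf w\}$, of dimension $d=\frac12N^2(N-1)$, with fixed basis $\{K_k\}$; $K(\mu)=\sum_k\mu_kK_k$ and $H(\Lambda,\mu)=H(\Lambda)+K(\mu)$, $\mu\in\mathbb{R}^d$. Certificate: for $\Lambda\in\mathcal F$, $P(\Lambda)\succ0$ is the unique solution of $A(\Lambda)^{\top}P+PA(\Lambda)=-I_N$, factored as $P=P_f^{\top}P_f$. With blocks $(M_i)_{rj}:=(H(\Lambda,\mu))_{r,(i-1)N+j}$, let $G(\Lambda,\mu)\in\mathbb{R}^{N^2\times N}$ be the vertical stacking of $M_i^{\top}P+PM_i$, $i=1,\dots,N$, and $J(\Lambda,\mu):=(P_f^{\top}\otimes I_N)^{-1}G(\Lambda,\mu)$ (its norm does not depend on the choice of factor $P_f$). Put $\rho^\star(\Lambda):=1/\phi(\Lambda)$ with $1/0:=+\infty$. An admissible gain box is a nonempty closed box $B=[\underline\Lambda,\overline\Lambda]\subset\mathbb{R}^m$ contained in $\mathcal F$; $\phi_B:=\min_{\Lambda\in B}\phi(\Lambda)$. "Global" for a positive definite quadratic form $V$ means that its derivative along the system satisfies $\dot V(\mathbf w)<0$ for every $\mathbf w\neq\mathbf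 0$. *)

theory Defs
  imports "HOL-Analysis.Analysis"
begin

definition hurwitz :: "real^'a^'a \<Rightarrow> bool" where
  "hurwitz A \<longleftrightarrow>
     (\<forall>(c::complex) (v::complex^'a).
        v \<noteq> 0 \<and> map_matrix complex_of_real A *v v = c *s v \<longrightarrow> Re c < 0)"

definition pos_def :: "real^'a^'a \<Rightarrow> bool" where
  "pos_def P \<longleftrightarrow> transpose P = P \<and> (\<forall>w. w \<noteq> 0 \<longrightarrow> w \<bullet> (P *v w) > 0)"

definition spectral_norm :: "real^'a^'b \<Rightarrow> real" where
  "spectral_norm A = onorm (\<lambda>v. A *v v)"

definition outer :: "real^'a \<Rightarrow> real^'b \<Rightarrow> real^'b^'a" where
  "outer u v = (\<chi> i j. u $ i * v $ j)"

text \<open>Throughout, the position \<open>(i - 1) N + j\<close> in a vector of length \<open>N\<^sup>2\<close> is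
  represented by the pair \<open>(i, j)\<close> of indices.\<close>

definition kron_vec :: "real^'a \<Rightarrow> real^'b \<Rightarrow> real^('a \<times> 'b)" where
  "kron_vec u v = (\<chi> q. u $ fst q * v $ snd q)"

definition kron_mat :: "real^'a^'c \<Rightarrow> real^'b^'d \<Rightarrow> real^('a \<times> 'b)^('c \<times> 'd)" where
  "kron_mat A B = (\<chi> p q. A $ fst p $ fst q * B $ snd p $ snd q)"

definition orbital_deriv :: "(real^'a \<Rightarrow> real) \<Rightarrow> (real^'a \<Rightarrow> real^'a) \<Rightarrow> real^'a \<Rightarrow> real" where
  "orbital_deriv V F w = frechet_derivative V (at w) (F w)"

definition quad_form :: "real^'a^'a \<Rightarrow> real^'a \<Rightarrow> real" where
  "quad_form P w = w \<bullet> (P *v w)"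

definition global_lyapunov :: "real^'a^'a \<Rightarrow> (real^'a \<Rightarrow> real^'a) \<Rightarrow> bool" where
  "global_lyapunov P F \<longleftrightarrow>
     pos_def P \<and> (\<forall>w. w \<noteq> 0 \<longrightarrow> orbital_deriv (quad_form P) F w < 0)"

definition locally_lipschitz_on ::
    "'a::metric_space set \<Rightarrow> ('a \<Rightarrow> 'b::metric_space) \<Rightarrow> bool" where
  "locally_lipschitz_on X f \<longleftrightarrow>
     (\<forall>x\<in>X. \<exists>u>0. \<exists>L. L-lipschitz_on (cball x u \<inter> X) f)"

text \<open>The type \<^typ>\<open>'n\<close> indexes the coordinates of \<open>x\<close> and \<^typ>\<open>'N\<close> those of
  \<open>w = (x, y)\<close>.  The injection \<open>xpos\<close> and the map \<open>ypos\<close> on \<open>{1..m}\<close> give the positions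
  of \<open>x\<^sub>j\<close> and \<open>y\<^sub>i\<close> in \<open>w\<close>; together they enumerate \<^typ>\<open>'N\<close>, so \<open>N = n + m\<close>.
  There is deliberately no index type of size \<open>m\<close>, which would exclude \<open>m = 0\<close>.

  The factors \<open>a\<^sub>i\<close> and \<open>b\<^sub>i\<close> are coordinates of \<open>w\<close>, hence given by their positions.
  \<open>facP\<close> is a choice of the factor \<open>P\<^sub>f\<close> for every gain.\<close>

record ('n, 'N) lift_data =
  mlift :: nat
  xpos :: "'n::finite \<Rightarrow> 'N::finite"
  ypos :: "nat \<Rightarrow> 'N"
  expo :: "nat \<Rightarrow> 'n \<Rightarrow> nat"
  fac_a :: "nat \<Rightarrow> 'N"
  fac_b :: "nat \<Rightarrow> 'N"
  A0 :: "real^'N^'N"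
  H0 :: "real^('N \<times> 'N)^'N"
  svec :: "nat \<Rightarrow> real^('N \<times> 'N)"
  Kbasis :: "nat \<Rightarrow> real^('N \<times> 'N)^'N"
  facP :: "real^'N \<Rightarrow> real^'N^'N"

definition gmon :: "('n::finite, 'N::finite) lift_data \<Rightarrow> nat \<Rightarrow> real^'n \<Rightarrow> real" where
  "gmon L i x = (\<Prod>j\<in>UNIV. (x $ j) ^ expo L i j)"

definition Phi :: "('n::finite, 'N::finite) lift_data \<Rightarrow> real^'n \<Rightarrow> real^'N" where
  "Phi L x = (\<Sum>j\<in>UNIV. x $ j *\<^sub>R axis (xpos L j) 1)
           + (\<Sum>i=1..mlift L. gmon L i x *\<^sub>R axis (ypos L i) 1)"

definition inner_quadratic_lift :: "('n::finite, 'N::finite) lift_data \<Rightarrow> bool" where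
  "inner_quadratic_lift L \<longleftrightarrow>
     inj (xpos L) \<and>
     bij_betw (ypos L) {1..mlift L} (- range (xpos L)) \<and>
     (\<forall>i\<in>{1..mlift L}. (\<Sum>j\<in>UNIV. expo L i j) \<ge> 2) \<and>
     (\<forall>i\<in>{1..mlift L}.
        fac_a L i \<in> range (xpos L) \<union> ypos L ` {1..<i} \<and>
        fac_b L i \<in> range (xpos L) \<union> ypos L ` {1..<i} \<and>
        (\<forall>x. gmon L i x = Phi L x $ fac_a L i * Phi L x $ fac_b L i))"

definition stabilizer :: "('n::finite, 'N::finite) lift_data \<Rightarrow> nat \<Rightarrow> real^'N \<Rightarrow> real" where
  "stabilizer L i w = w $ ypos L i - w $ fac_a L i * w $ fac_b L i"

definition F0 :: "('n::finite, 'N::finite) lift_data \<Rightarrow> real^'N \<Rightarrow> real^'N" where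
  "F0 L w = A0 L *v w + H0 L *v kron_vec w w"

definition reference_extension ::
    "(real^'n \<Rightarrow> real^'n) \<Rightarrow> ('n::finite, 'N::finite) lift_data \<Rightarrow> bool" where
  "reference_extension p L \<longleftrightarrow>
     (\<forall>x. F0 L (Phi L x) = jacobian (Phi L) (at x) *v p x)"

text \<open>A gain vector \<open>\<Lambda>\<close> in \<open>\<real>\<^sup>m\<close> is represented by its zero padding in \<open>\<real>\<^sup>N\<close>:
  \<open>\<lambda>\<^sub>i\<close> is stored at \<open>ypos i\<close> and the \<open>x\<close>-coordinates vanish.  The padding is a linear
  isometry that preserves the componentwise order, so Lipschitz conditions and boxes
  (\<^const>\<open>cbox\<close>) in \<open>\<real>\<^sup>m\<close> carry over unchanged.\<close>

definition gain_space :: "('n::finite, 'N::finite) lift_data \<Rightarrow> (real^'N) set" where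
  "gain_space L = {\<Lambda>. \<forall>j. \<Lambda> $ xpos L j = 0}"

definition F_stab ::
    "('n::finite, 'N::finite) lift_data \<Rightarrow> real^'N \<Rightarrow> real^'N \<Rightarrow> real^'N" where
  "F_stab L \<Lambda> w = F0 L w
     - (\<Sum>i=1..mlift L. (\<Lambda> $ ypos L i * stabilizer L i w) *\<^sub>R axis (ypos L i) 1)"

definition A_stab :: "('n::finite, 'N::finite) lift_data \<Rightarrow> real^'N \<Rightarrow> real^'N^'N" where
  "A_stab L \<Lambda> = A0 L
     - (\<Sum>i=1..mlift L. \<Lambda> $ ypos L i *\<^sub>R outer (axis (ypos L i) 1) (axis (ypos L i) 1))"

definition H_stab ::
    "('n::finite, 'N::finite) lift_data \<Rightarrow> real^'N \<Rightarrow> real^('N \<times> 'N)^'N" where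
  "H_stab L \<Lambda> = H0 L
     + (\<Sum>i=1..mlift L. \<Lambda> $ ypos L i *\<^sub>R outer (axis (ypos L i) 1) (svec L i))"

definition svec_spec :: "('n::finite, 'N::finite) lift_data \<Rightarrow> bool" where
  "svec_spec L \<longleftrightarrow>
     (\<forall>i\<in>{1..mlift L}. \<forall>w. svec L i \<bullet> kron_vec w w = w $ fac_a L i * w $ fac_b L i)"

definition feasible :: "('n::finite, 'N::finite) lift_data \<Rightarrow> (real^'N) set" where
  "feasible L = {\<Lambda> \<in> gain_space L. hurwitz (A_stab L \<Lambda>)}"

definition gauge_space :: "(real^('N::finite \<times> 'N)^'N) set" where
  "gauge_space = {K. \<forall>w. K *v kron_vec w w = 0}"

definition gauge_dim :: "('n::finite, 'N::finite) lift_data \<Rightarrow> nat" where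
  "gauge_dim L = CARD('N)^2 * (CARD('N) - 1) div 2"

definition gauge_basis :: "('n::finite, 'N::finite) lift_data \<Rightarrow> bool" where
  "gauge_basis L \<longleftrightarrow>
     inj_on (Kbasis L) {1..gauge_dim L} \<and>
     independent (Kbasis L ` {1..gauge_dim L}) \<and>
     span (Kbasis L ` {1..gauge_dim L}) = gauge_space"

text \<open>\<open>\<real>\<^sup>d\<close> as a set of functions on \<open>{1..d}\<close>; note that \<open>d = 0\<close> if \<open>N = 1\<close>.\<close>

definition gauge_params :: "('n::finite, 'N::finite) lift_data \<Rightarrow> (nat \<Rightarrow> real) set" where
  "gauge_params L = {1..gauge_dim L} \<rightarrow>\<^sub>E UNIV"

definition H_gauge ::
    "('n::finite, 'N::finite) lift_data \<Rightarrow> real^'N \<Rightarrow> (nat \<Rightarrow> real) \<Rightarrow> real^('N \<times> 'N)^'N" where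
  "H_gauge L \<Lambda> \<mu> = H_stab L \<Lambda> + (\<Sum>k=1..gauge_dim L. \<mu> k *\<^sub>R Kbasis L k)"

definition lyap_P :: "('n::finite, 'N::finite) lift_data \<Rightarrow> real^'N \<Rightarrow> real^'N^'N" where
  "lyap_P L \<Lambda> =
     (THE P. transpose (A_stab L \<Lambda>) ** P + P ** A_stab L \<Lambda> = - mat 1)"

definition factor_spec :: "('n::finite, 'N::finite) lift_data \<Rightarrow> bool" where
  "factor_spec L \<longleftrightarrow>
     (\<forall>\<Lambda>\<in>feasible L. lyap_P L \<Lambda> = transpose (facP L \<Lambda>) ** facP L \<Lambda>)"

definition H_block :: "real^('N \<times> 'N)^'N \<Rightarrow> 'N \<Rightarrow> real^'N^'N::finite" where
  "H_block H i = (\<chi> r j. H $ r $ (i, j))"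

definition G_mat ::
    "('n::finite, 'N::finite) lift_data \<Rightarrow> real^'N \<Rightarrow> (nat \<Rightarrow> real) \<Rightarrow> real^'N^('N \<times> 'N)" where
  "G_mat L \<Lambda> \<mu> =
     (\<chi> q j. let M = H_block (H_gauge L \<Lambda> \<mu>) (fst q); P = lyap_P L \<Lambda>
            in (transpose M ** P + P ** M) $ snd q $ j)"

definition J_mat ::
    "('n::finite, 'N::finite) lift_data \<Rightarrow> real^'N \<Rightarrow> (nat \<Rightarrow> real) \<Rightarrow> real^'N^('N \<times> 'N)" where
  "J_mat L \<Lambda> \<mu> =
     matrix_inv (kron_mat (transpose (facP L \<Lambda>)) (mat 1 :: real^'N^'N)) ** G_mat L \<Lambda> \<mu>"

text \<open>The minima defining \<open>\<phi>\<close> and \<open>\<phi>\<^sub>B\<close> are written as infima; that they are attained is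
  part of the statement.\<close>

definition phi :: "('n::finite, 'N::finite) lift_data \<Rightarrow> real^'N \<Rightarrow> real" where
  "phi L \<Lambda> = (INF \<mu>\<in>gauge_params L. spectral_norm (J_mat L \<Lambda> \<mu>))"

text \<open>In \<^typ>\<open>ereal\<close>, \<open>1 / 0 = \<infinity>\<close>.\<close>

definition rho_star :: "('n::finite, 'N::finite) lift_data \<Rightarrow> real^'N \<Rightarrow> ereal" where
  "rho_star L \<Lambda> = 1 / ereal (phi L \<Lambda>)"

definition admissible_box :: "('n::finite, 'N::finite) lift_data \<Rightarrow> (real^'N) set \<Rightarrow> bool" where
  "admissible_box L B \<longleftrightarrow>
     (\<exists>lo\<in>gain_space L. \<exists>hi\<in>gain_space L. B = cbox lo hi) \<and> B \<noteq> {} \<and> B \<subseteq> feasible L"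

definition phi_box :: "('n::finite, 'N::finite) lift_data \<Rightarrow> (real^'N) set \<Rightarrow> real" where
  "phi_box L B = (INF \<Lambda>\<in>B. phi L \<Lambda>)"

end

theory Submission
  imports Defs "HOL-Computational_Algebra.Fundamental_Theorem_Algebra"
begin

text \<open>
  The difficulty is that the minimisation over the gauge is neither compact nor strictly
  convex: the gauge parameters are unbounded, and different parameters may give the same \<open>J\<close>.
  Both obstacles disappear after a change of variables.  Let \<open>G(P, H)\<close> be the stacked matrix of
  the blocks \<open>M\<^sub>i\<^sup>T P + P M\<^sub>i\<close>, which is bilinear in \<open>P\<close> and \<open>H\<close>.  As \<open>P\<close> is symmetric,
  \<open>G(P, K) = G(I, P K)\<close>, and \<open>K \<mapsto> P K\<close> maps the gauge space onto itself
  (\<open>stacked_lyapunov_symmetric\<close>, \<open>gauge_space_mult\<close>).  Hence the set of all matrices \<open>G\<close> at the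
  gain \<open>\<Lambda>\<close> is the translate of one fixed subspace \<open>W = G(I, \<K>)\<close>, independent of \<open>\<Lambda>\<close>, by
  \<open>g(\<Lambda>) = G(P(\<Lambda>), H(\<Lambda>))\<close> (\<open>range_G_mat\<close>), and
  \<open>\<phi>(\<Lambda>) = min {\<nu>\<^sub>\<Lambda>(g(\<Lambda>) + U) | U \<in> W}\<close> for the norm
  \<open>\<nu>\<^sub>\<Lambda>(X) = \<parallel>(P\<^sub>f\<^sup>T \<otimes> I)\<^sup>-\<^sup>1 X\<parallel>\<close>.

  The minimum is attained because a norm is coercive and a subspace is closed.  For the Lipschitz
  bound, a minimiser at one gain is tested at a nearby one (\<open>min_over_translate_lipschitz\<close>).  This
  needs that \<open>g\<close> is locally Lipschitz and that \<open>\<nu>\<^sub>\<Lambda>' \<le> (1 + b \<bar>\<Lambda> - \<Lambda>'\<bar>) \<nu>\<^sub>\<Lambda>\<close> locally.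
  The latter follows from a comparison of the factors, \<open>\<bar>P\<^sub>f(\<Lambda>) w\<bar> \<le> k \<bar>P\<^sub>f(\<Lambda>') w\<bar>\<close>, that is,
  of the quadratic forms \<open>w\<^sup>T P w\<close> (\<open>factor_norm_mono\<close>, \<open>facP_comparison\<close>).  So everything reduces
  to \<open>P\<close> being locally Lipschitz, and that is a perturbation argument for the linear operator
  \<open>X \<mapsto> A\<^sup>T X + X A\<close>, which is invertible for Hurwitz \<open>A\<close> (\<open>hurwitz_lyapunov_injective\<close>,
  \<open>bilinear_solution_lipschitz\<close>).

  Local Lipschitz continuity gives continuity, hence a minimiser on the compact box.
  If \<open>J = 0\<close>, then \<open>w\<^sup>T P M\<^sub>i w = 0\<close> for every block, so the quadratic part of the vector field
  contributes nothing to the derivative of \<open>V\<close>, which is therefore \<open>-\<bar>w\<bar>\<^sup>2\<close>.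
\<close>

section \<open>Polynomials of a matrix\<close>

text \<open>
  Horner evaluation with the matrix product; \<^const>\<open>poly\<close> would use the componentwise product of
  the type class.
\<close>

definition matrix_poly :: "'a::field poly \<Rightarrow> 'a^'n^'n \<Rightarrow> 'a^'n^'n" where
  "matrix_poly q A = fold_coeffs (\<lambda>a S. mat a + S ** A) q 0"

lemma matrix_poly_0 [simp]: "matrix_poly 0 A = 0"
  by (simp add: matrix_poly_def)

lemma matrix_poly_pCons [simp]: "matrix_poly (pCons a q) A = mat a + matrix_poly q A ** A"
  by (cases "q = 0 \<and> a = 0") (auto simp: matrix_poly_def)

lemma mat_add: "mat (a + b) = mat a + (mat b :: 'a::semiring_1^'n^'n)"
  by (simp add: mat_def vec_eq_iff)

lemma matrix_mat_mult_nth: "(mat c ** (A :: 'a::semiring_1^'m^'n)) $ i $ j = c * A $ i $ j"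
  by (simp add: matrix_matrix_mult_def mat_def if_distrib if_distribR sum.delta' cong: if_cong)

lemma matrix_mult_mat_nth: "((A :: 'a::semiring_1^'n^'m) ** mat c) $ i $ j = A $ i $ j * c"
  by (simp add: matrix_matrix_mult_def mat_def if_distrib if_distribR sum.delta cong: if_cong)

lemma mat_mult_commute: "mat c ** A = A ** mat c" for A :: "'a::comm_semiring_1^'n^'m"
  by (simp add: vec_eq_iff matrix_mat_mult_nth matrix_mult_mat_nth mult.commute)

lemma matrix_add_rdistrib: "(A + B) ** C = A ** C + B ** C"
  by (simp add: vec_eq_iff matrix_matrix_mult_def distrib_right sum.distrib)

lemma matrix_poly_add: "matrix_poly (p + q) A = matrix_poly p A + matrix_poly q A"
  by (induction p q rule: poly_induct2) (simp_all add: mat_add matrix_add_rdistrib algebra_simps)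

lemma matrix_poly_smult: "matrix_poly (smult c p) A = mat c ** matrix_poly p A"
proof (induction p)
  case (pCons a p)
  have "mat (c * a) = mat c ** (mat a :: 'a^'b^'b)"
    by (simp add: vec_eq_iff matrix_mat_mult_nth) (simp add: mat_def)
  with pCons show ?case
    by (simp add: matrix_add_ldistrib matrix_mul_assoc)
qed simp

lemma matrix_poly_sum: "matrix_poly (sum f S) A = (\<Sum>i\<in>S. matrix_poly (f i) A)"
  by (induction S rule: infinite_finite_induct) (simp_all add: matrix_poly_add)

lemma matrix_poly_commute: "A ** matrix_poly q A = matrix_poly q A ** A"
proof (induction q)
  case (pCons a q)
  then show ?case
    by (simp add: matrix_add_ldistrib matrix_add_rdistrib matrix_mul_assoc mat_mult_commute [of a A])
qed simp

text \<open>
  More than \<open>DIM('a)\<close> vectors are linearly dependent.  Formulated for sequences, so that a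
  repetition in the sequence also counts as a relation.
\<close>

lemma linear_relation_in_sequence:
  fixes f :: "nat \<Rightarrow> 'a::euclidean_space"
  obtains u where "(\<Sum>i\<le>DIM('a). u i *\<^sub>R f i) = 0" "\<exists>i\<le>DIM('a). u i \<noteq> 0"
proof (cases "inj_on f {..DIM('a)}")
  case True
  then have "dependent (f ` {..DIM('a)})"
    by (intro dependent_biggerset) (simp add: card_image)
  then obtain w v where w: "(\<Sum>x\<in>f ` {..DIM('a)}. w x *\<^sub>R x) = 0" "v \<in> f ` {..DIM('a)}" "w v \<noteq> 0"
    by (subst (asm) dependent_finite) auto
  have "(\<Sum>i\<le>DIM('a). (w \<circ> f) i *\<^sub>R f i) = 0"
    using w(1) True by (simp add: sum.reindex)
  moreover have "\<exists>i\<le>DIM('a). (w \<circ> f) i \<noteq> 0"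
    using w(2,3) by auto
  ultimately show ?thesis by (rule that)
next
  case False
  then obtain i j where ij: "i \<le> DIM('a)" "j \<le> DIM('a)" "i \<noteq> j" "f i = f j"
    by (auto simp: inj_on_def)
  define u where "u k = (if k = i then 1 else 0) - (if k = j then 1 else 0::real)" for k
  have "(\<Sum>k\<le>DIM('a). u k *\<^sub>R f k) =
    (\<Sum>k\<le>DIM('a). if k = i then f k else 0) - (\<Sum>k\<le>DIM('a). if k = j then f k else 0)"
    unfolding sum_subtractf [symmetric] by (intro sum.cong) (auto simp: u_def)
  also have "\<dots> = 0"
    using ij by (simp add: sum.delta)
  finally have "(\<Sum>k\<le>DIM('a). u k *\<^sub>R f k) = 0" .
  moreover have "u i \<noteq> 0"
    using \<open>i \<noteq> j\<close> by (simp add: u_def)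
  then have "\<exists>i\<le>DIM('a). u i \<noteq> 0"
    using \<open>i \<le> DIM('a)\<close> by (intro exI [of _ i] conjI)
  ultimately show ?thesis
    by (rule that)
qed

text \<open>
  The powers of \<open>A\<close> lie in a space of finite real dimension, so a real linear relation between them
  already exists.
\<close>

lemma annihilating_polynomial:
  fixes A :: "complex^'n^'n"
  obtains q where "q \<noteq> 0" "matrix_poly q A = 0"
proof -
  obtain u where u: "(\<Sum>i\<le>DIM(complex^'n^'n). u i *\<^sub>R matrix_poly (monom 1 i) A) = 0"
      "\<exists>i\<le>DIM(complex^'n^'n). u i \<noteq> 0"
    by (rule linear_relation_in_sequence [of "\<lambda>i. matrix_poly (monom 1 i) A"])
  define q where "q = (\<Sum>i\<le>DIM(complex^'n^'n). monom (complex_of_real (u i)) i)"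
  have coeff: "coeff q i = (if i \<le> DIM(complex^'n^'n) then complex_of_real (u i) else 0)" for i
    by (simp add: q_def coeff_sum sum.delta)
  have "matrix_poly (monom (complex_of_real (u i)) i) A = u i *\<^sub>R matrix_poly (monom 1 i) A" for i
  proof -
    have "monom (complex_of_real (u i)) i = smult (u i) (monom 1 i)"
      by (simp add: smult_monom)
    then show ?thesis
      by (simp only: matrix_poly_smult) (simp add: vec_eq_iff matrix_mat_mult_nth, simp add: scaleR_conv_of_real)
  qed
  then have "matrix_poly q A = 0"
    using u(1) by (simp add: q_def matrix_poly_sum)
  moreover have "q \<noteq> 0"
    using u(2) coeff by (metis coeff_0 of_real_eq_0_iff)
  ultimately show ?thesis using that by blast
qed

section \<open>The Lyapunov operator of a Hurwitz matrix\<close>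

lemma eigenvalue_imp_transpose_eigenvalue:
  fixes A :: "'a::field^'n^'n"
  assumes "z \<noteq> 0" "transpose A *v z = c *s z"
  obtains v where "v \<noteq> 0" "A *v v = c *s v"
proof -
  have mat: "mat c *v v = c *s v" for v :: "'a^'n"
    by (simp add: vec_eq_iff matrix_vector_mult_def mat_def if_distrib if_distribR sum.delta' cong: if_cong)
  have "transpose (A - mat c) = transpose A - mat c"
    by (simp add: transpose_def mat_def vec_eq_iff)
  then have "transpose (A - mat c) *v z = 0"
    using assms(2) by (simp add: matrix_vector_mult_diff_rdistrib mat del: transpose_matrix_vector)
  then have "\<not> invertible (transpose (A - mat c))"
    using assms(1) matrix_left_invertible_ker [of "transpose (A - mat c)"] unfolding invertible_def by blast
  then have "\<not> invertible (A - mat c)"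
    by (simp add: invertible_det_nz)
  then have "\<not> (\<exists>B. B ** (A - mat c) = mat 1)"
    using matrix_left_right_inverse unfolding invertible_def by blast
  then obtain v where "v \<noteq> 0" "(A - mat c) *v v = 0"
    unfolding matrix_left_invertible_ker by blast
  then show ?thesis
    using that by (simp add: matrix_vector_mult_diff_rdistrib mat)
qed

lemma map_matrix_of_real_mult:
  "map_matrix complex_of_real (A ** B) = map_matrix complex_of_real A ** map_matrix complex_of_real B"
  for A :: "real^'n^'m" and B :: "real^'k^'n"
  by (simp add: vec_eq_iff matrix_matrix_mult_def)

text \<open>
  The complex solutions of the homogeneous equation are closed under \<open>X \<mapsto> X A\<close>, so a nonzero
  solution gives rise to an eigenvector of this map: a solution \<open>Y \<noteq> 0\<close> with \<open>Y A = c Y\<close> and therefore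
  \<open>A\<^sup>T Y = -c Y\<close>.  Rows of \<open>Y\<close> show that \<open>c\<close> is an eigenvalue of \<open>A\<close>, columns that \<open>-c\<close> is one, and
  they cannot both have negative real part.
\<close>

lemma hurwitz_lyapunov_injective:
  fixes A X :: "real^'n^'n"
  assumes A: "hurwitz A" and X: "transpose A ** X + X ** A = 0"
  shows "X = 0"
proof (rule ccontr)
  assume "X \<noteq> 0"
  define A' X' where "A' = map_matrix complex_of_real A" and "X' = map_matrix complex_of_real X"
  have "X' \<noteq> 0"
    using \<open>X \<noteq> 0\<close> by (auto simp: X'_def vec_eq_iff)
  have X': "transpose A' ** X' = - (X' ** A')"
  proof -
    have "transpose A ** X = - (X ** A)"
      using X by (simp add: eq_neg_iff_add_eq_0)
    then have "map_matrix complex_of_real (transpose A ** X) = map_matrix complex_of_real (- (X ** A))"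
      by simp
    moreover have "map_matrix complex_of_real (transpose A) = transpose A'"
      by (simp add: A'_def transpose_def vec_eq_iff)
    moreover have "map_matrix complex_of_real (- M) = - map_matrix complex_of_real M" for M :: "real^'n^'n"
      by (simp add: vec_eq_iff)
    ultimately show ?thesis
      by (simp add: A'_def X'_def map_matrix_of_real_mult)
  qed
  \<comment> \<open>\<open>Y = X r(A)\<close>, where \<open>(x - c) r\<close> has minimal degree among the nonzero \<open>q\<close> with \<open>X q(A) = 0\<close>\<close>
  define ann where "ann d \<longleftrightarrow> (\<exists>q. q \<noteq> 0 \<and> X' ** matrix_poly q A' = 0 \<and> degree q = d)" for d
  obtain q0 where "q0 \<noteq> 0" "matrix_poly q0 A' = 0"
    by (rule annihilating_polynomial)
  then have "ann (degree q0)"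
    by (auto simp: ann_def)
  then have "ann (LEAST d. ann d)"
    by (rule LeastI)
  then obtain q where q: "q \<noteq> 0" "X' ** matrix_poly q A' = 0" and least: "degree q = (LEAST d. ann d)"
    by (auto simp: ann_def)
  have min: "X' ** matrix_poly r A' \<noteq> 0" if "r \<noteq> 0" "degree r < degree q" for r
    using that not_less_Least [of "degree r" ann] by (auto simp: ann_def least)
  have "degree q \<noteq> 0"
  proof
    assume "degree q = 0"
    then obtain a where a: "q = [:a:]"
      by (rule degree_eq_zeroE)
    with q have "X' ** mat a = 0" "a \<noteq> 0"
      by auto
    then show False
      using \<open>X' \<noteq> 0\<close> by (simp add: vec_eq_iff matrix_mult_mat_nth)
  qed
  then obtain c where "poly q c = 0"
    using fundamental_theorem_of_algebra [of q] constant_degree [of q] by auto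
  then obtain r where r: "q = [:- c, 1:] * r"
    by (auto simp: poly_eq_0_iff_dvd elim: dvdE)
  with q have "r \<noteq> 0" by auto
  then have "degree r < degree q"
    by (simp add: r degree_mult_eq del: mult_pCons_left)
  define Y where "Y = X' ** matrix_poly r A'"
  have "Y \<noteq> 0"
    unfolding Y_def by (rule min) fact+
  have YA: "Y ** A' = mat c ** Y"
  proof -
    have "q + smult c r = pCons 0 r"
      by (simp add: r)
    then have "matrix_poly (q + smult c r) A' = matrix_poly r A' ** A'"
      by simp
    then have "X' ** (matrix_poly q A' + mat c ** matrix_poly r A') = Y ** A'"
      by (simp add: matrix_poly_add matrix_poly_smult Y_def matrix_mul_assoc)
    then show ?thesis
      using q(2) by (simp add: matrix_add_ldistrib matrix_mul_assoc Y_def mat_mult_commute [of c X', symmetric])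
  qed
  have neg: "- M ** N = - (M ** N)" for M N :: "complex^'n^'n"
    by (simp add: vec_eq_iff matrix_matrix_mult_def sum_negf)
  have AY: "transpose A' ** Y = - (mat c ** Y)"
  proof -
    have "transpose A' ** Y = - (X' ** (A' ** matrix_poly r A'))"
      by (simp add: Y_def matrix_mul_assoc X' neg)
    also have "\<dots> = - (Y ** A')"
      by (simp add: matrix_poly_commute Y_def matrix_mul_assoc)
    finally show ?thesis by (simp add: YA)
  qed
  have left: "Re b < 0" if "z \<noteq> 0" "transpose A' *v z = b *s z" for b z
  proof -
    obtain v where "v \<noteq> 0" "A' *v v = b *s v"
      using eigenvalue_imp_transpose_eigenvalue \<open>z \<noteq> 0\<close> \<open>transpose A' *v z = b *s z\<close> by blast
    then show ?thesis
      using A by (auto simp: hurwitz_def A'_def)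
  qed
  obtain i j where "Y $ i $ j \<noteq> 0"
    using \<open>Y \<noteq> 0\<close> by (auto simp: vec_eq_iff)
  have "Re c < 0"
  proof (rule left)
    show "row i Y \<noteq> 0"
      using \<open>Y $ i $ j \<noteq> 0\<close> by (auto simp: row_def vec_eq_iff)
    have "(Y ** A') $ i = (mat c ** Y) $ i"
      by (simp add: YA)
    then show "transpose A' *v row i Y = c *s row i Y"
      by (simp add: vec_eq_iff matrix_mat_mult_nth row_def)
        (simp add: matrix_matrix_mult_def vector_matrix_mult_def mult.commute)
  qed
  moreover have "Re (- c) < 0"
  proof (rule left)
    show "column j Y \<noteq> 0"
      using \<open>Y $ i $ j \<noteq> 0\<close> by (auto simp: column_def vec_eq_iff)
    have "(transpose A' ** Y) $ k $ j = (- (mat c ** Y)) $ k $ j" for k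
      by (simp add: AY)
    then show "transpose A' *v column j Y = - c *s column j Y"
      by (simp add: vec_eq_iff matrix_mat_mult_nth column_def)
        (simp add: matrix_matrix_mult_def matrix_vector_mult_def vector_matrix_mult_def transpose_def mult.commute)
  qed
  ultimately show False by simp
qed

section \<open>Perturbation and minimisation in finite dimension\<close>

text \<open>
  \<open>T(a, \<cdot>)\<close> is bounded below by \<open>c\<close> at \<open>a\<^sub>0\<close>, hence by \<open>c / 2\<close> near \<open>a\<^sub>0\<close>.  This bounds the solutions, and
  applied to \<open>T(a, x - y) = T(b - a, y)\<close> it bounds their difference.
\<close>

lemma bilinear_solution_lipschitz:
  fixes T :: "'a::real_normed_vector \<Rightarrow> 'b::euclidean_space \<Rightarrow> 'c::euclidean_space"
  assumes T: "bounded_bilinear T" and inj: "inj (T a\<^sub>0)"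
  obtains u C where "u > 0" "C \<ge> 0"
    "\<And>a b x y. \<lbrakk>a \<in> cball a\<^sub>0 u; b \<in> cball a\<^sub>0 u; T a x = q; T b y = q\<rbrakk> \<Longrightarrow> dist x y \<le> C * dist a b"
proof -
  interpret bounded_bilinear T by (rule T)
  obtain K where K: "K > 0" "\<And>a x. norm (T a x) \<le> norm a * norm x * K"
    using pos_bounded by blast
  have "linear (T a\<^sub>0)"
    by (simp add: bounded_linear.linear bounded_linear_right)
  then obtain c where c: "c > 0" "\<And>x. c * norm x \<le> norm (T a\<^sub>0 x)"
    using linear_inj_bounded_below_pos [OF _ inj] by (metis mult.commute)
  have below: "c / 2 * norm x \<le> norm (T a x)" if "a \<in> cball a\<^sub>0 (c / (2 * K))" for a x
  proof -
    have "norm (a\<^sub>0 - a) * K \<le> c / 2"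
      using that K(1) by (simp add: dist_norm field_simps)
    then have "norm (a\<^sub>0 - a) * K * norm x \<le> c / 2 * norm x"
      by (rule mult_right_mono) simp
    then have "norm (T (a\<^sub>0 - a) x) \<le> c / 2 * norm x"
      using K(2) [of "a\<^sub>0 - a" x] by (simp add: mult_ac)
    moreover have "norm (T a\<^sub>0 x) \<le> norm (T a x) + norm (T (a\<^sub>0 - a) x)"
      using norm_triangle_ineq [of "T a x" "T (a\<^sub>0 - a) x"] by (simp add: diff_left)
    ultimately show ?thesis
      using c(2) [of x] by simp
  qed
  show ?thesis
  proof (rule that [of "c / (2 * K)" "(2 / c)^2 * K * norm q"])
    fix a b x y
    assume a: "a \<in> cball a\<^sub>0 (c / (2 * K))" and b: "b \<in> cball a\<^sub>0 (c / (2 * K))"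
      and q: "T a x = q" "T b y = q"
    have "T a (x - y) = T (b - a) y"
      using q by (simp add: diff_left diff_right)
    then have "c / 2 * norm (x - y) \<le> norm (T (b - a) y)"
      using below [OF a, of "x - y"] by simp
    also have "\<dots> \<le> norm (b - a) * norm y * K"
      by (rule K)
    also have "\<dots> \<le> norm (b - a) * (2 / c * norm q) * K"
      using below [OF b, of y] q c K(1)
      by (intro mult_right_mono mult_left_mono) (auto simp: field_simps)
    finally show "dist x y \<le> (2 / c)^2 * K * norm q * dist a b"
      using c by (simp add: dist_norm field_simps power2_eq_square norm_minus_commute)
  qed (use c K in auto)
qed

text \<open>
  The lower bound confines the competitors of any one point of \<open>W\<close> to a compact set.
\<close>

lemma attains_min_on_translate:
  fixes f :: "'a::euclidean_space \<Rightarrow> real"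
  assumes W: "closed W" "W \<noteq> {}" and f: "continuous_on UNIV f"
    and c: "c > 0" "\<And>x. c * norm x \<le> f x"
  obtains u where "u \<in> W" "\<And>v. v \<in> W \<Longrightarrow> f (g + u) \<le> f (g + v)"
proof -
  obtain v\<^sub>0 where "v\<^sub>0 \<in> W"
    using W by blast
  let ?S = "W \<inter> cball (- g) (f (g + v\<^sub>0) / c)"
  have in_S: "v \<in> ?S" if "v \<in> W" "f (g + v) \<le> f (g + v\<^sub>0)" for v
  proof -
    have "c * norm (g + v) \<le> f (g + v\<^sub>0)"
      using c(2) [of "g + v"] that by simp
    moreover have "dist (- g) v = norm (g + v)"
      using norm_minus_cancel [of "g + v"] by (simp add: dist_norm)
    ultimately show ?thesis
      using that c by (simp add: field_simps)
  qed
  have "compact ?S"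
    using W by (simp add: closed_Int_compact)
  moreover have "?S \<noteq> {}"
    using in_S [OF \<open>v\<^sub>0 \<in> W\<close>] by blast
  moreover have "continuous_on ?S (\<lambda>v. f (g + v))"
    by (rule continuous_on_compose2 [OF f]) (auto intro: continuous_intros)
  ultimately obtain u where u: "u \<in> ?S" "\<And>v. v \<in> ?S \<Longrightarrow> f (g + u) \<le> f (g + v)"
    using continuous_attains_inf [of ?S "\<lambda>v. f (g + v)"] by blast
  have "f (g + u) \<le> f (g + v)" if "v \<in> W" for v
    using u(2) [OF in_S] u(2) [OF in_S [OF \<open>v\<^sub>0 \<in> W\<close>]] that by fastforce
  with u(1) show ?thesis
    using that by blast
qed

section \<open>The spectral norm\<close>

lemma spectral_norm_bound: "norm (A *v x) \<le> spectral_norm A * norm x"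
  unfolding spectral_norm_def by (rule onorm) simp

lemma spectral_norm_le: "(\<And>x. norm (A *v x) \<le> b * norm x) \<Longrightarrow> spectral_norm A \<le> b"
  unfolding spectral_norm_def by (rule onorm_le)

lemma spectral_norm_nonneg [simp]: "0 \<le> spectral_norm A"
  unfolding spectral_norm_def by (rule onorm_pos_le) simp

lemma spectral_norm_eq_0: "spectral_norm A = 0 \<longleftrightarrow> A = 0"
  unfolding spectral_norm_def by (subst onorm_eq_0) (auto simp: matrix_eq)

lemma spectral_norm_triangle: "spectral_norm (A + B) \<le> spectral_norm A + spectral_norm B"
proof -
  have "(\<lambda>x. A *v x + B *v x) = (*v) (A + B)"
    by (simp add: fun_eq_iff matrix_vector_mult_add_rdistrib)
  then show ?thesis
    unfolding spectral_norm_def using onorm_triangle [of "(*v) A" "(*v) B"] by simp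
qed

lemma spectral_norm_mult: "spectral_norm (A ** B) \<le> spectral_norm A * spectral_norm B"
  unfolding spectral_norm_def
  using onorm_compose [of "(*v) A" "(*v) B"] by (simp add: o_def matrix_vector_mul_assoc)

lemma spectral_norm_le_norm:
  "spectral_norm (A :: real^'n^'m) \<le> real CARD('m) * real CARD('n) * norm A"
  unfolding spectral_norm_def
proof (rule onorm_le_matrix_component)
  fix i j
  show "\<bar>A $ i $ j\<bar> \<le> norm A"
    using component_le_norm_cart [of "A $ i" j] Finite_Cartesian_Product.norm_nth_le [of A i] by linarith
qed

lemma norm_le_spectral_norm:
  "norm (A :: real^'n^'m) \<le> real CARD('m) * real CARD('n) * spectral_norm A"
proof -
  have "norm A \<le> (\<Sum>i\<in>UNIV. norm (A $ i))"
    unfolding norm_vec_def by (rule L2_set_le_sum) simp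
  also have "\<dots> \<le> (\<Sum>i\<in>UNIV. \<Sum>j\<in>UNIV. \<bar>A $ i $ j\<bar>)"
    by (intro sum_mono norm_le_l1_cart)
  also have "\<dots> \<le> (\<Sum>i\<in>(UNIV::'m set). \<Sum>j\<in>(UNIV::'n set). spectral_norm A)"
    unfolding spectral_norm_def by (intro sum_mono matrix_component_le_onorm)
  finally show ?thesis
    by (simp add: mult.assoc)
qed

section \<open>The norm weighted by a factor of the Lyapunov matrix\<close>

lemma sum_UNIV_prod: "(\<Sum>q\<in>UNIV. f q) = (\<Sum>a\<in>UNIV. \<Sum>b\<in>UNIV. f (a, b))"
  for f :: "'a::finite \<times> 'b::finite \<Rightarrow> 'c::comm_monoid_add"
  unfolding UNIV_Times_UNIV [symmetric] by (rule sum.cartesian_product')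

lemma kron_mat_mult_mat_1:
  "kron_mat A (mat 1) ** kron_mat B (mat 1) = kron_mat (A ** B) (mat 1 :: real^'s^'s)"
  for A :: "real^'n^'m" and B :: "real^'k^'n"
proof -
  have "(\<Sum>q\<in>UNIV. A $ fst p $ fst q * mat 1 $ snd p $ snd q * (B $ fst q $ fst r * mat 1 $ snd q $ snd r))
      = (\<Sum>a\<in>UNIV. A $ fst p $ a * B $ a $ fst r) * (mat 1 :: real^'s^'s) $ snd p $ snd r"
    for p :: "'m \<times> 's" and r :: "'k \<times> 's"
  proof -
    have "(\<Sum>q\<in>UNIV. A $ fst p $ fst q * mat 1 $ snd p $ snd q * (B $ fst q $ fst r * mat 1 $ snd q $ snd r))
      = (\<Sum>a\<in>UNIV. \<Sum>s\<in>UNIV. if s = snd p then A $ fst p $ a * B $ a $ fst r * (mat 1 :: real^'s^'s) $ snd p $ snd r else 0)"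
      unfolding sum_UNIV_prod by (intro sum.cong refl) (simp add: mat_def)
    then show ?thesis
      by (simp add: sum_distrib_right)
  qed
  then show ?thesis
    by (simp add: vec_eq_iff kron_mat_def matrix_matrix_mult_def)
qed

lemma kron_mat_mat_1: "kron_mat (mat 1) (mat 1) = mat 1"
  by (auto simp: vec_eq_iff kron_mat_def mat_def prod_eq_iff)

lemma transpose_kron_mat: "transpose (kron_mat A B) = kron_mat (transpose A) (transpose B)"
  by (simp add: vec_eq_iff kron_mat_def transpose_def)

text \<open>
  \<open>F \<otimes> I\<close> acts separately on the slices of \<open>v\<close> with a fixed second index, so inequalities between
  \<open>\<bar>F w\<bar>\<close> for different \<open>F\<close> carry over to \<open>\<bar>(F \<otimes> I) v\<bar>\<close>.
\<close>

lemma norm_kron_mat_mult_vec: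
  "(norm (kron_mat F (mat 1 :: real^'s^'s) *v v))\<^sup>2 = (\<Sum>s\<in>UNIV. (norm (F *v (\<chi> r. v $ (r, s))))\<^sup>2)"
  for F :: "real^'n^'m"
proof -
  have "(kron_mat F (mat 1 :: real^'s^'s) *v v) $ (a, s) = (F *v (\<chi> r. v $ (r, s))) $ a" for a s
  proof -
    have "(\<Sum>q\<in>UNIV. F $ a $ fst q * (mat 1 :: real^'s^'s) $ s $ snd q * v $ q) = (\<Sum>r\<in>UNIV. F $ a $ r * v $ (r, s))"
      by (simp add: sum_UNIV_prod mat_def if_distrib if_distribR sum.delta sum.delta' cong: if_cong)
    then show ?thesis
      by (simp add: kron_mat_def matrix_vector_mult_def)
  qed
  then have "(norm (kron_mat F (mat 1 :: real^'s^'s) *v v))\<^sup>2 = (\<Sum>a\<in>UNIV. \<Sum>s\<in>UNIV. ((F *v (\<chi> r. v $ (r, s))) $ a)\<^sup>2)"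
    by (simp add: norm_vec_def L2_set_def sum_nonneg sum_UNIV_prod)
  also have "\<dots> = (\<Sum>s\<in>UNIV. \<Sum>a\<in>UNIV. ((F *v (\<chi> r. v $ (r, s))) $ a)\<^sup>2)"
    by (rule sum.swap)
  also have "\<dots> = (\<Sum>s\<in>UNIV. (norm (F *v (\<chi> r. v $ (r, s))))\<^sup>2)"
    by (simp add: norm_vec_def L2_set_def sum_nonneg)
  finally show ?thesis .
qed

lemma norm_kron_mat_mono:
  assumes le: "\<And>w. norm (F *v w) \<le> k * norm (F' *v w)" and "k \<ge> 0"
  shows "norm (kron_mat F (mat 1) *v v) \<le> k * norm (kron_mat F' (mat 1) *v v)"
proof (rule power2_le_imp_le)
  have "(norm (F *v w))\<^sup>2 \<le> k\<^sup>2 * (norm (F' *v w))\<^sup>2" for w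
    using power_mono [OF le norm_ge_zero, of w 2] by (simp add: power_mult_distrib)
  then show "(norm (kron_mat F (mat 1) *v v))\<^sup>2 \<le> (k * norm (kron_mat F' (mat 1) *v v))\<^sup>2"
    by (simp add: norm_kron_mat_mult_vec power_mult_distrib sum_distrib_left sum_mono)
qed (use \<open>k \<ge> 0\<close> in simp)

text \<open>
  The norm under which \<open>J\<close> is measured, as a norm of \<open>G\<close>.  For \<open>P = F\<^sup>T F\<close> its square is the largest value
  of \<open>(X v)\<^sup>T (P\<^sup>-\<^sup>1 \<otimes> I) (X v)\<close> over unit vectors \<open>v\<close>.
\<close>

definition factor_norm :: "real^'n^'n \<Rightarrow> real^'k^('n::finite \<times> 's::finite) \<Rightarrow> real" where
  "factor_norm F X = spectral_norm (matrix_inv (kron_mat (transpose F) (mat 1 :: real^'s^'s)) ** X)"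

lemma invertible_kron_mat:
  fixes F :: "real^'n^'n"
  assumes "invertible F"
  shows "invertible (kron_mat (transpose F) (mat 1 :: real^'s^'s))"
proof -
  have "invertible (transpose F)"
    using assms by (simp add: invertible_det_nz)
  then obtain B where "B ** transpose F = mat 1" "transpose F ** B = mat 1"
    unfolding invertible_def by blast
  then show ?thesis
    unfolding invertible_def by (metis kron_mat_mult_mat_1 kron_mat_mat_1)
qed

lemma matrix_inv:
  assumes "invertible A"
  shows matrix_inv_left: "matrix_inv A ** A = mat 1" and matrix_inv_right: "A ** matrix_inv A = mat 1"
  using someI_ex [OF assms [unfolded invertible_def]] unfolding matrix_inv_def by blast+

text \<open>
  With \<open>E = F\<^sup>T \<otimes> I\<close> and \<open>E' = F'\<^sup>T \<otimes> I\<close>, the claim is that \<open>Q = E'\<^sup>-\<^sup>1 E\<close> has norm at most \<open>k\<close>.  The hypothesis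
  says this of the transpose \<open>E\<^sup>T (E'\<^sup>T)\<^sup>-\<^sup>1\<close>, and a matrix and its transpose have the same norm.
\<close>

lemma factor_norm_mono:
  assumes F: "invertible F" "invertible F'"
    and le: "\<And>w. norm (F *v w) \<le> k * norm (F' *v w)" and "k \<ge> 0"
  shows "factor_norm F' (X :: real^'k^('n::finite \<times> 's::finite)) \<le> k * factor_norm F X"
proof -
  define E where "E = kron_mat (transpose F) (mat 1 :: real^'s^'s)"
  define E' where "E' = kron_mat (transpose F') (mat 1 :: real^'s^'s)"
  have inv: "E ** matrix_inv E = mat 1" "matrix_inv E' ** E' = mat 1"
    unfolding E_def E'_def using F by (simp_all add: invertible_kron_mat matrix_inv)
  have T: "transpose E = kron_mat F (mat 1)" "transpose E' = kron_mat F' (mat 1)"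
    by (simp_all add: E_def E'_def transpose_kron_mat)
  let ?Q = "matrix_inv E' ** E"
  have "spectral_norm ?Q \<le> k"
  proof (rule spectral_norm_le)
    fix z
    \<comment> \<open>\<open>y = (E'\<^sup>T)\<^sup>-\<^sup>1 Q z\<close>, so that \<open>\<bar>Q z\<bar>\<^sup>2 = \<langle>E\<^sup>T y, z\<rangle>\<close> and \<open>E'\<^sup>T y = Q z\<close>\<close>
    let ?y = "transpose (matrix_inv E') *v (?Q *v z)"
    have "transpose E' ** transpose (matrix_inv E') = mat 1"
      by (metis inv(2) matrix_transpose_mul transpose_mat)
    then have y: "transpose E' *v ?y = ?Q *v z"
      by (metis matrix_vector_mul_assoc matrix_vector_mul_lid)
    have "(norm (?Q *v z))\<^sup>2 = (?Q *v z) \<bullet> (matrix_inv E' *v (E *v z))"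
      by (simp add: power2_norm_eq_inner matrix_vector_mul_assoc)
    also have "\<dots> = (transpose E *v ?y) \<bullet> z"
      by (simp add: dot_lmul_matrix)
    also have "\<dots> \<le> norm (transpose E *v ?y) * norm z"
      by (rule norm_cauchy_schwarz)
    also have "\<dots> \<le> k * norm (transpose E' *v ?y) * norm z"
      unfolding T by (intro mult_right_mono norm_kron_mat_mono le) (use \<open>k \<ge> 0\<close> in auto)
    finally have "norm (?Q *v z) * norm (?Q *v z) \<le> norm (?Q *v z) * (k * norm z)"
      unfolding y by (simp add: power2_eq_square mult_ac)
    then show "norm (?Q *v z) \<le> k * norm z"
      by (cases "norm (?Q *v z) = 0") (use \<open>k \<ge> 0\<close> in \<open>simp_all add: mult_le_cancel_left\<close>)
  qed
  have "matrix_inv E' ** X = ?Q ** (matrix_inv E ** X)"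
    by (metis inv(1) matrix_mul_assoc matrix_mul_lid)
  then have "factor_norm F' X \<le> spectral_norm ?Q * spectral_norm (matrix_inv E ** X)"
    unfolding factor_norm_def E'_def [symmetric] by (metis spectral_norm_mult)
  also have "\<dots> \<le> k * factor_norm F X"
    unfolding factor_norm_def E_def [symmetric] by (rule mult_right_mono) (simp_all add: \<open>spectral_norm ?Q \<le> k\<close>)
  finally show ?thesis .
qed

lemma factor_norm_nonneg [simp]: "0 \<le> factor_norm F X"
  by (simp add: factor_norm_def)

lemma factor_norm_triangle: "factor_norm F (X + Y) \<le> factor_norm F X + factor_norm F Y"
  by (simp add: factor_norm_def matrix_add_ldistrib spectral_norm_triangle)

lemma factor_norm_upper:
  obtains C where "C \<ge> 0" "\<And>X :: real^'k^('n::finite \<times> 's::finite). factor_norm F X \<le> C * norm X"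
proof -
  let ?D = "matrix_inv (kron_mat (transpose F) (mat 1 :: real^'s^'s))"
  let ?c = "real CARD('n::finite \<times> 's::finite) * real CARD('k)"
  have "factor_norm F X \<le> spectral_norm ?D * ?c * norm X" for X :: "real^'k^('n::finite \<times> 's::finite)"
  proof -
    have "factor_norm F X \<le> spectral_norm ?D * spectral_norm X"
      unfolding factor_norm_def by (rule spectral_norm_mult)
    also have "\<dots> \<le> spectral_norm ?D * (?c * norm X)"
      by (intro mult_left_mono spectral_norm_le_norm) simp
    finally show ?thesis by (simp add: mult.assoc)
  qed
  then show ?thesis
    by (intro that [of "spectral_norm ?D * ?c"]) auto
qed

lemma factor_norm_lower:
  assumes "invertible F"
  obtains c where "c > 0" "\<And>X :: real^'k^('n::finite \<times> 's::finite). c * norm X \<le> factor_norm F X"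
proof -
  let ?E = "kron_mat (transpose F) (mat 1 :: real^'s^'s)"
  let ?c = "real CARD('n::finite \<times> 's::finite) * real CARD('k)"
  have bound: "norm X \<le> (?c * spectral_norm ?E + 1) * factor_norm F X" for X :: "real^'k^('n::finite \<times> 's::finite)"
  proof -
    have "X = ?E ** (matrix_inv ?E ** X)"
      by (simp add: matrix_mul_assoc matrix_inv_right invertible_kron_mat assms)
    then have "spectral_norm X \<le> spectral_norm ?E * factor_norm F X"
      unfolding factor_norm_def by (metis spectral_norm_mult)
    then have "norm X \<le> ?c * (spectral_norm ?E * factor_norm F X)"
      by (intro order_trans [OF norm_le_spectral_norm] mult_left_mono) auto
    also have "\<dots> \<le> (?c * spectral_norm ?E + 1) * factor_norm F X"
      by (simp add: algebra_simps)
    finally show ?thesis .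
  qed
  have pos: "?c * spectral_norm ?E + 1 > 0"
    by (intro add_nonneg_pos mult_nonneg_nonneg) auto
  then show ?thesis
    by (intro that [of "1 / (?c * spectral_norm ?E + 1)"])
      (use bound in \<open>auto simp: divide_le_eq mult.commute\<close>)
qed

lemma continuous_on_factor_norm: "continuous_on UNIV (factor_norm F :: real^'k^('n::finite \<times> 's::finite) \<Rightarrow> real)"
proof -
  obtain C where C: "C \<ge> 0" "\<And>X :: real^'k^('n::finite \<times> 's::finite). factor_norm F X \<le> C * norm X"
    using factor_norm_upper [where F = F and 'k = 'k and 's = 's] by blast
  have "factor_norm F X - factor_norm F Y \<le> C * norm (X - Y)" for X Y :: "real^'k^('n::finite \<times> 's::finite)"
    using factor_norm_triangle [of F Y "X - Y"] C(2) [of "X - Y"] by simp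
  from this this [of Y X for X Y]
  have "\<bar>factor_norm F X - factor_norm F Y\<bar> \<le> C * norm (X - Y)" for X Y :: "real^'k^('n::finite \<times> 's::finite)"
    by (metis abs_le_iff minus_diff_eq norm_minus_commute)
  then have "C-lipschitz_on UNIV (factor_norm F :: real^'k^('n::finite \<times> 's::finite) \<Rightarrow> real)"
    using C(1) by (intro lipschitz_onI) (auto simp: dist_norm)
  then show ?thesis
    by (rule lipschitz_on_continuous_on)
qed

section \<open>Lipschitz estimates\<close>

lemma bounded_bilinear_lipschitz_on:
  assumes T: "bounded_bilinear T"
    and f: "C-lipschitz_on S f" "bounded (f ` S)" and g: "D-lipschitz_on S g" "bounded (g ` S)"
  obtains E where "E-lipschitz_on S (\<lambda>x. T (f x) (g x))"
proof -
  interpret bounded_bilinear T by (rule T)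
  obtain K where K: "K > 0" "\<And>a b. norm (T a b) \<le> norm a * norm b * K"
    using pos_bounded by blast
  obtain F G where F: "\<And>x. x \<in> S \<Longrightarrow> norm (f x) \<le> F" "F > 0" and G: "\<And>x. x \<in> S \<Longrightarrow> norm (g x) \<le> G" "G > 0"
    using f(2) g(2) unfolding bounded_pos by auto
  have "C \<ge> 0" "D \<ge> 0"
    using f(1) g(1) lipschitz_on_nonneg by blast+
  show ?thesis
  proof (rule that, rule lipschitz_onI)
    fix x y assume xy: "x \<in> S" "y \<in> S"
    have "T (f x) (g x) - T (f y) (g y) = T (f x - f y) (g x) + T (f y) (g x - g y)"
      by (simp add: diff_left diff_right)
    then have "dist (T (f x) (g x)) (T (f y) (g y)) \<le> norm (T (f x - f y) (g x)) + norm (T (f y) (g x - g y))"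
      unfolding dist_norm by (metis norm_triangle_ineq)
    also have "\<dots> \<le> norm (f x - f y) * norm (g x) * K + norm (f y) * norm (g x - g y) * K"
      by (intro add_mono K)
    also have "\<dots> \<le> (C * dist x y) * G * K + F * (D * dist x y) * K"
      using K(1) F G xy lipschitz_onD [OF f(1) xy] lipschitz_onD [OF g(1) xy] \<open>C \<ge> 0\<close> \<open>D \<ge> 0\<close>
      by (intro add_mono mult_mono) (auto simp: dist_norm)
    finally show "dist (T (f x) (g x)) (T (f y) (g y)) \<le> (C * G * K + F * D * K) * dist x y"
      by (simp add: algebra_simps)
  qed (use \<open>C \<ge> 0\<close> \<open>D \<ge> 0\<close> F G K in auto)
qed

lemma lipschitz_on_bounded_image:
  fixes f :: "'a::metric_space \<Rightarrow> 'b::metric_space"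
  assumes f: "C-lipschitz_on S f" and "bounded S"
  shows "bounded (f ` S)"
proof (cases "S = {}")
  case False
  then obtain a where "a \<in> S" by blast
  obtain d where d: "\<And>x. x \<in> S \<Longrightarrow> dist a x \<le> d"
    using \<open>bounded S\<close> bounded_any_center [of S a] by auto
  have "dist (f a) (f x) \<le> C * d" if "x \<in> S" for x
    using lipschitz_onD [OF f \<open>a \<in> S\<close> that] d [OF that] lipschitz_on_nonneg [OF f]
    by (meson mult_left_mono order_trans)
  then show ?thesis
    unfolding bounded_def by blast
qed simp

text \<open>
  A minimiser \<open>u\<close> at \<open>x\<close> is a competitor at \<open>y\<close>.  Passing from \<open>\<nu> x (g x + u)\<close> to \<open>\<nu> y (g y + u)\<close> costs
  \<open>b d(x, y) \<phi> x\<close> for the change of norm and \<open>C D d(x, y)\<close> for the change of \<open>g\<close>.  The competitor \<open>0\<close>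
  gives \<open>\<phi> x \<le> C M\<close>.
\<close>

lemma min_over_translate_lipschitz:
  fixes \<nu> :: "'a::metric_space \<Rightarrow> 'b::real_normed_vector \<Rightarrow> real"
  assumes attained: "\<And>x. x \<in> S \<Longrightarrow> \<exists>u\<in>W. \<phi> x = \<nu> x (g x + u)"
    and le: "\<And>x u. \<lbrakk>x \<in> S; u \<in> W\<rbrakk> \<Longrightarrow> \<phi> x \<le> \<nu> x (g x + u)" and "0 \<in> W"
    and triangle: "\<And>x v w. x \<in> S \<Longrightarrow> \<nu> x (v + w) \<le> \<nu> x v + \<nu> x w"
    and upper: "\<And>x v. x \<in> S \<Longrightarrow> \<nu> x v \<le> C * norm v" and "C \<ge> 0"
    and compare: "\<And>x y v. \<lbrakk>x \<in> S; y \<in> S\<rbrakk> \<Longrightarrow> \<nu> y v \<le> (1 + b * dist x y) * \<nu> x v" and "b \<ge> 0"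
    and g: "D-lipschitz_on S g" and M: "\<And>x. x \<in> S \<Longrightarrow> norm (g x) \<le> M" and "M \<ge> 0"
  shows "(b * (C * M) + C * D)-lipschitz_on S \<phi>"
proof -
  have "D \<ge> 0"
    using g by (rule lipschitz_on_nonneg)
  have *: "\<phi> y - \<phi> x \<le> (b * (C * M) + C * D) * dist x y" if xy: "x \<in> S" "y \<in> S" for x y
  proof -
    obtain u where u: "u \<in> W" "\<phi> x = \<nu> x (g x + u)"
      using attained [OF \<open>x \<in> S\<close>] by blast
    have "\<phi> x \<le> \<nu> x (g x + 0)"
      using le [OF \<open>x \<in> S\<close> \<open>0 \<in> W\<close>] .
    also have "\<dots> \<le> C * norm (g x)"
      using upper [OF \<open>x \<in> S\<close>] by simp
    also have "\<dots> \<le> C * M"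
      using M [OF \<open>x \<in> S\<close>] \<open>C \<ge> 0\<close> by (rule mult_left_mono)
    finally have "\<phi> x \<le> C * M" .
    have "\<phi> y \<le> \<nu> y ((g x + u) + (g y - g x))"
      using le [OF \<open>y \<in> S\<close> u(1)] by (simp add: algebra_simps)
    also have "\<dots> \<le> \<nu> y (g x + u) + \<nu> y (g y - g x)"
      by (rule triangle [OF \<open>y \<in> S\<close>])
    also have "\<dots> \<le> (1 + b * dist x y) * \<phi> x + C * (D * dist x y)"
    proof (rule add_mono)
      show "\<nu> y (g x + u) \<le> (1 + b * dist x y) * \<phi> x"
        unfolding u(2) by (rule compare [OF xy])
      have "norm (g y - g x) \<le> D * dist x y"
        using lipschitz_onD [OF g xy] by (simp add: dist_norm norm_minus_commute)
      then show "\<nu> y (g y - g x) \<le> C * (D * dist x y)"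
        by (intro order_trans [OF upper [OF \<open>y \<in> S\<close>]] mult_left_mono \<open>C \<ge> 0\<close>)
    qed
    also have "\<dots> \<le> \<phi> x + b * dist x y * (C * M) + C * (D * dist x y)"
      using mult_left_mono [OF \<open>\<phi> x \<le> C * M\<close>, of "b * dist x y"] \<open>b \<ge> 0\<close> by (simp add: distrib_right)
    finally show ?thesis
      by (simp add: algebra_simps)
  qed
  show ?thesis
  proof (rule lipschitz_onI)
    fix x y assume "x \<in> S" "y \<in> S"
    then show "dist (\<phi> x) (\<phi> y) \<le> (b * (C * M) + C * D) * dist x y"
      using * [of x y] * [of y x] by (auto simp: dist_real_def abs_le_iff dist_commute)
  qed (use \<open>b \<ge> 0\<close> \<open>C \<ge> 0\<close> \<open>D \<ge> 0\<close> \<open>M \<ge> 0\<close> in simp)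
qed

section \<open>The Lyapunov equation and the certificate matrix as bilinear maps\<close>

definition lyapunov_op :: "real^'n^'n \<Rightarrow> real^'n^'n \<Rightarrow> real^'n^'n" where
  "lyapunov_op A P = transpose A ** P + P ** A"

lemma bounded_bilinear_lyapunov_op: "bounded_bilinear lyapunov_op"
  unfolding bilinear_conv_bounded_bilinear [symmetric] bilinear_def
  by (auto intro!: linearI simp: lyapunov_op_def vec_eq_iff matrix_matrix_mult_def transpose_def
      algebra_simps sum.distrib sum_distrib_left)

lemma inj_lyapunov_op:
  assumes "hurwitz A"
  shows "inj (lyapunov_op A)"
proof -
  interpret bounded_bilinear lyapunov_op
    by (rule bounded_bilinear_lyapunov_op)
  have "X = Y" if "lyapunov_op A X = lyapunov_op A Y" for X Y
    using hurwitz_lyapunov_injective [OF assms, of "X - Y"] that diff_right [of A X Y]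
    by (simp add: lyapunov_op_def)
  then show ?thesis
    by (rule injI)
qed

lemma lyapunov_equation_unique_solution:
  assumes "hurwitz A"
  shows "\<exists>!P. lyapunov_op A P = Q"
proof -
  interpret bounded_bilinear lyapunov_op
    by (rule bounded_bilinear_lyapunov_op)
  have "surj (lyapunov_op A)"
    by (rule linear_injective_imp_surjective)
      (simp_all add: inj_lyapunov_op assms bounded_linear.linear bounded_linear_right)
  then show ?thesis
    by (metis assms inj_lyapunov_op injD surjD)
qed

text \<open>
  The matrix \<open>G\<close> of the certificate as a function of \<open>P\<close> and \<open>H\<close>.
\<close>

definition stacked_lyapunov :: "real^'n^'n \<Rightarrow> real^('n::finite \<times> 'n)^'n \<Rightarrow> real^'n^('n \<times> 'n)" where
  "stacked_lyapunov P H = (\<chi> q j. lyapunov_op (H_block H (fst q)) P $ snd q $ j)"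

lemma G_mat_eq: "G_mat L \<Lambda> \<mu> = stacked_lyapunov (lyap_P L \<Lambda>) (H_gauge L \<Lambda> \<mu>)"
  by (simp add: G_mat_def stacked_lyapunov_def lyapunov_op_def Let_def)

lemma bounded_bilinear_stacked_lyapunov: "bounded_bilinear stacked_lyapunov"
  unfolding bilinear_conv_bounded_bilinear [symmetric] bilinear_def
  by (auto intro!: linearI simp: stacked_lyapunov_def lyapunov_op_def H_block_def vec_eq_iff
      matrix_matrix_mult_def transpose_def algebra_simps sum.distrib sum_distrib_left)

lemma stacked_lyapunov_eq_0_iff: "stacked_lyapunov P H = 0 \<longleftrightarrow> (\<forall>i. lyapunov_op (H_block H i) P = 0)"
  by (auto simp: stacked_lyapunov_def vec_eq_iff)

lemma H_block_mult: "H_block (P ** H) i = P ** H_block H i"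
  by (simp add: H_block_def matrix_matrix_mult_def vec_eq_iff)

text \<open>
  Transferring \<open>P\<close> to the second argument frees the gauge directions from their dependence on the
  gain: \<open>(M\<^sub>i)\<^sup>T P + P M\<^sub>i = (P M\<^sub>i)\<^sup>T + P M\<^sub>i\<close>.
\<close>

lemma stacked_lyapunov_symmetric:
  assumes "transpose P = P"
  shows "stacked_lyapunov P K = stacked_lyapunov (mat 1) (P ** K)"
  by (simp add: stacked_lyapunov_def lyapunov_op_def H_block_mult matrix_transpose_mul assms)

section \<open>The gauge\<close>

lemma subspace_gauge_space: "subspace gauge_space"
  by (rule subspaceI)
    (auto simp: gauge_space_def matrix_vector_mult_add_rdistrib scaleR_matrix_vector_assoc [symmetric])

lemma gauge_space_mult: "K \<in> gauge_space \<Longrightarrow> P ** K \<in> gauge_space"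
  by (simp add: gauge_space_def matrix_vector_mul_assoc [symmetric])

text \<open>
  The directions in which the gauge moves \<open>G\<close>, the same for every gain.
\<close>

definition gauge_image :: "(real^'n^('n::finite \<times> 'n)) set" where
  "gauge_image = stacked_lyapunov (mat 1) ` gauge_space"

lemma subspace_gauge_image: "subspace gauge_image"
  unfolding gauge_image_def
  by (intro linear_subspace_image subspace_gauge_space bounded_linear.linear
      bounded_bilinear.bounded_linear_right bounded_bilinear_stacked_lyapunov)

lemma gauge_params_sum_in_gauge_space:
  assumes "gauge_basis L"
  shows "(\<Sum>k=1..gauge_dim L. \<mu> k *\<^sub>R Kbasis L k) \<in> gauge_space"
  using assms by (auto simp: gauge_basis_def intro!: subspace_sum subspace_scale subspace_gauge_space span_base)

text \<open>
  Restriction to \<open>{1..d}\<close> makes the coefficients extensional, as membership in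
  \<^const>\<open>gauge_params\<close> demands.
\<close>

lemma gauge_params_represent:
  assumes "gauge_basis L" "K \<in> gauge_space"
  obtains \<mu> where "\<mu> \<in> gauge_params L" "K = (\<Sum>k=1..gauge_dim L. \<mu> k *\<^sub>R Kbasis L k)"
proof -
  have inj: "inj_on (Kbasis L) {1..gauge_dim L}" and "K \<in> span (Kbasis L ` {1..gauge_dim L})"
    using assms by (auto simp: gauge_basis_def)
  then obtain w where "K = (\<Sum>v\<in>Kbasis L ` {1..gauge_dim L}. w v *\<^sub>R v)"
    by (auto simp: span_finite)
  also have "\<dots> = (\<Sum>k=1..gauge_dim L. w (Kbasis L k) *\<^sub>R Kbasis L k)"
    using inj by (simp add: sum.reindex)
  also have "\<dots> = (\<Sum>k=1..gauge_dim L. restrict (w \<circ> Kbasis L) {1..gauge_dim L} k *\<^sub>R Kbasis L k)"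
    by (rule sum.cong) auto
  finally show ?thesis
    by (intro that [of "restrict (w \<circ> Kbasis L) {1..gauge_dim L}"]) (auto simp: gauge_params_def)
qed

section \<open>The Lyapunov matrix as a function of the gain\<close>

lemma gain_combination_lipschitz:
  fixes M :: "nat \<Rightarrow> 'b::real_normed_vector" and S :: "(real^'n) set"
  shows "(\<Sum>i\<in>I. norm (M i))-lipschitz_on S (\<lambda>\<Lambda>. \<Sum>i\<in>I. \<Lambda> $ k i *\<^sub>R M i)"
proof (rule lipschitz_onI)
  fix x y :: "real^'n"
  have "dist (\<Sum>i\<in>I. x $ k i *\<^sub>R M i) (\<Sum>i\<in>I. y $ k i *\<^sub>R M i) = norm (\<Sum>i\<in>I. (x - y) $ k i *\<^sub>R M i)"
    by (simp add: dist_norm sum_subtractf scaleR_left_diff_distrib)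
  also have "\<dots> \<le> (\<Sum>i\<in>I. dist x y * norm (M i))"
    by (intro order_trans [OF norm_sum] sum_mono)
      (simp add: dist_norm mult_right_mono component_le_norm_cart del: vector_minus_component)
  finally show "dist (\<Sum>i\<in>I. x $ k i *\<^sub>R M i) (\<Sum>i\<in>I. y $ k i *\<^sub>R M i) \<le> (\<Sum>i\<in>I. norm (M i)) * dist x y"
    by (simp add: sum_distrib_left mult.commute)
qed (simp add: sum_nonneg)

lemma A_stab_lipschitz: "\<exists>C. C-lipschitz_on UNIV (A_stab L)"
  unfolding A_stab_def
  by (rule exI, rule lipschitz_on_diff [OF lipschitz_on_constant gain_combination_lipschitz])

lemma H_stab_lipschitz: "\<exists>C. C-lipschitz_on UNIV (H_stab L)"
  unfolding H_stab_def
  by (rule exI, rule lipschitz_on_add [OF lipschitz_on_constant gain_combination_lipschitz])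

lemma lyap_P_equation:
  assumes "\<Lambda> \<in> feasible L"
  shows "lyapunov_op (A_stab L \<Lambda>) (lyap_P L \<Lambda>) = - mat 1"
proof -
  have "\<exists>!P. lyapunov_op (A_stab L \<Lambda>) P = - mat 1"
    using assms by (intro lyapunov_equation_unique_solution) (simp add: feasible_def)
  then show ?thesis
    unfolding lyapunov_op_def lyap_P_def by (rule theI')
qed

lemma lyap_P_locally_lipschitz:
  assumes "\<Lambda>\<^sub>0 \<in> feasible L"
  obtains u C where "u > 0" "C-lipschitz_on (cball \<Lambda>\<^sub>0 u \<inter> feasible L) (lyap_P L)"
proof -
  have "inj (lyapunov_op (A_stab L \<Lambda>\<^sub>0))"
    using assms by (intro inj_lyapunov_op) (simp add: feasible_def)
  then obtain u C where u: "u > 0" "C \<ge> 0"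
    and C: "\<And>A B X Y. \<lbrakk>A \<in> cball (A_stab L \<Lambda>\<^sub>0) u; B \<in> cball (A_stab L \<Lambda>\<^sub>0) u;
       lyapunov_op A X = - mat 1; lyapunov_op B Y = - mat 1\<rbrakk> \<Longrightarrow> dist X Y \<le> C * dist A B"
    using bilinear_solution_lipschitz [OF bounded_bilinear_lyapunov_op, where q = "- mat 1"] by blast
  obtain D where D: "D-lipschitz_on UNIV (A_stab L)"
    using A_stab_lipschitz by blast
  have "D \<ge> 0"
    using D by (rule lipschitz_on_nonneg)
  have near: "A_stab L x \<in> cball (A_stab L \<Lambda>\<^sub>0) u" if "x \<in> cball \<Lambda>\<^sub>0 (u / (D + 1))" for x
  proof -
    have "dist (A_stab L \<Lambda>\<^sub>0) (A_stab L x) \<le> D * dist \<Lambda>\<^sub>0 x"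
      by (rule lipschitz_onD [OF D]) auto
    also have "\<dots> \<le> (D + 1) * (u / (D + 1))"
      using that \<open>D \<ge> 0\<close> by (intro mult_mono) auto
    finally show ?thesis
      using \<open>D \<ge> 0\<close> by simp
  qed
  have "(C * D)-lipschitz_on (cball \<Lambda>\<^sub>0 (u / (D + 1)) \<inter> feasible L) (lyap_P L)"
  proof (rule lipschitz_onI)
    fix x y
    assume "x \<in> cball \<Lambda>\<^sub>0 (u / (D + 1)) \<inter> feasible L" "y \<in> cball \<Lambda>\<^sub>0 (u / (D + 1)) \<inter> feasible L"
    then have "dist (lyap_P L x) (lyap_P L y) \<le> C * dist (A_stab L x) (A_stab L y)"
      by (intro C near lyap_P_equation) auto
    also have "\<dots> \<le> C * (D * dist x y)"
      using lipschitz_onD [OF D, of x y] \<open>C \<ge> 0\<close> by (intro mult_left_mono) auto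
    finally show "dist (lyap_P L x) (lyap_P L y) \<le> C * D * dist x y"
      by simp
  qed (use \<open>C \<ge> 0\<close> \<open>D \<ge> 0\<close> in simp)
  then show ?thesis
    using u \<open>D \<ge> 0\<close> by (intro that [of "u / (D + 1)"]) auto
qed

lemma lyap_P_factor:
  assumes "factor_spec L" "\<Lambda> \<in> feasible L"
  shows "lyap_P L \<Lambda> = transpose (facP L \<Lambda>) ** facP L \<Lambda>"
  using assms by (simp add: factor_spec_def)

lemma lyap_P_symmetric:
  assumes "factor_spec L" "\<Lambda> \<in> feasible L"
  shows "transpose (lyap_P L \<Lambda>) = lyap_P L \<Lambda>"
  by (simp add: lyap_P_factor [OF assms] matrix_transpose_mul)

lemma lyap_P_quadratic_form:
  assumes "factor_spec L" "\<Lambda> \<in> feasible L"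
  shows "w \<bullet> (lyap_P L \<Lambda> *v w) = (norm (facP L \<Lambda> *v w))\<^sup>2"
  unfolding lyap_P_factor [OF assms] power2_norm_eq_inner
  by (metis dot_lmul_matrix matrix_vector_mul_assoc transpose_matrix_vector vector_transpose_matrix inner_commute)

lemma symmetric_lyapunov_form:
  assumes "transpose P = P"
  shows "w \<bullet> (lyapunov_op M P *v w) = 2 * (w \<bullet> (P *v (M *v w)))"
proof -
  have "w \<bullet> (transpose M *v (P *v w)) = (M *v w) \<bullet> (P *v w)"
    by (metis dot_lmul_matrix transpose_matrix_vector vector_transpose_matrix inner_commute)
  also have "\<dots> = w \<bullet> (P *v (M *v w))"
    by (metis assms dot_lmul_matrix transpose_matrix_vector inner_commute)
  finally show ?thesis
    by (simp add: lyapunov_op_def matrix_vector_mult_add_rdistrib inner_add_right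
        matrix_vector_mul_assoc [symmetric] del: transpose_matrix_vector)
qed

lemma lyap_P_decay:
  assumes "factor_spec L" "\<Lambda> \<in> feasible L"
  shows "2 * (w \<bullet> (lyap_P L \<Lambda> *v (A_stab L \<Lambda> *v w))) = - (norm w)\<^sup>2"
proof -
  have "- mat 1 *v w = - w"
    using matrix_vector_mult_diff_rdistrib [of 0 "mat 1" w] by simp
  then show ?thesis
    using symmetric_lyapunov_form [OF lyap_P_symmetric [OF assms], of w "A_stab L \<Lambda>"]
    by (simp add: lyap_P_equation assms power2_norm_eq_inner)
qed

text \<open>
  If \<open>P\<^sub>f w = 0\<close>, then \<open>P w = 0\<close>, and the Lyapunov equation tested with \<open>w\<close> gives
  \<open>\<bar>w\<bar>\<^sup>2 = -2 w\<^sup>T P A w = 0\<close>.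
\<close>

lemma facP_invertible:
  assumes "factor_spec L" "\<Lambda> \<in> feasible L"
  shows "invertible (facP L \<Lambda>)"
proof -
  have "w = 0" if "facP L \<Lambda> *v w = 0" for w
  proof -
    have "lyap_P L \<Lambda> *v w = 0"
      by (metis lyap_P_factor [OF assms] matrix_vector_mul_assoc matrix_vector_mult_0_right that)
    then have "w \<bullet> (lyap_P L \<Lambda> *v v) = 0" for v
      by (metis dot_lmul_matrix inner_zero_left lyap_P_symmetric [OF assms] transpose_matrix_vector)
    then show ?thesis
      using lyap_P_decay [OF assms, of w] by simp
  qed
  then have "\<exists>B. B ** facP L \<Lambda> = mat 1"
    unfolding matrix_left_invertible_ker by blast
  then show ?thesis
    using matrix_left_right_inverse unfolding invertible_def by blast
qed

text \<open>
  The factorisation makes the form nonnegative; it is definite because the Lyapunov equation forces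
  the factor to be invertible.
\<close>

lemma lyap_P_pos_def:
  assumes "factor_spec L" "\<Lambda> \<in> feasible L"
  shows "pos_def (lyap_P L \<Lambda>)"
proof -
  have "facP L \<Lambda> *v w \<noteq> 0" if "w \<noteq> 0" for w
    using that inj_matrix_vector_mult [OF facP_invertible [OF assms]]
    by (metis injD matrix_vector_mult_0_right)
  then show ?thesis
    using assms by (simp add: pos_def_def lyap_P_symmetric lyap_P_quadratic_form)
qed

text \<open>
  \<open>\<bar>P\<^sub>f w\<bar>\<^sup>2 = w\<^sup>T P w\<close> depends on \<open>P\<close> only.  Between two gains it changes by at most a multiple of
  \<open>d(x, y) \<bar>w\<bar>\<^sup>2\<close>, which is a multiple of \<open>d(x, y) w\<^sup>T P w\<close> because \<open>P\<close> is uniformly positive near \<open>\<Lambda>\<^sub>0\<close>.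
\<close>

lemma facP_comparison:
  fixes L :: "('n::finite, 'N::finite) lift_data"
  assumes L: "factor_spec L" and "\<Lambda>\<^sub>0 \<in> feasible L"
    and P: "C-lipschitz_on (cball \<Lambda>\<^sub>0 u \<inter> feasible L) (lyap_P L)" and "u > 0"
  obtains v b where "0 < v" "v \<le> u" "b \<ge> 0"
    "\<And>x y w. \<lbrakk>x \<in> cball \<Lambda>\<^sub>0 v \<inter> feasible L; y \<in> cball \<Lambda>\<^sub>0 v \<inter> feasible L\<rbrakk> \<Longrightarrow>
       norm (facP L x *v w) \<le> (1 + b * dist x y) * norm (facP L y *v w)"
proof -
  define n where "n = real CARD('N) * real CARD('N)"
  have "n > 0"
    by (simp add: n_def)
  have "C \<ge> 0"
    using P by (rule lipschitz_on_nonneg)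
  have diff: "w \<bullet> (lyap_P L x *v w) \<le> w \<bullet> (lyap_P L y *v w) + n * C * dist x y * (norm w)\<^sup>2"
    if "x \<in> cball \<Lambda>\<^sub>0 u \<inter> feasible L" "y \<in> cball \<Lambda>\<^sub>0 u \<inter> feasible L" for x y and w :: "real^'N"
  proof -
    let ?D = "lyap_P L x - lyap_P L y"
    have "w \<bullet> (?D *v w) \<le> norm w * norm (?D *v w)"
      by (rule norm_cauchy_schwarz)
    also have "\<dots> \<le> norm w * (spectral_norm ?D * norm w)"
      by (intro mult_left_mono spectral_norm_bound) simp
    also have "\<dots> = spectral_norm ?D * (norm w)\<^sup>2"
      by (simp add: power2_eq_square)
    also have "\<dots> \<le> (n * (C * dist x y)) * (norm w)\<^sup>2"
    proof (rule mult_right_mono)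
      have "spectral_norm ?D \<le> n * norm ?D"
        unfolding n_def by (rule spectral_norm_le_norm)
      also have "\<dots> \<le> n * (C * dist x y)"
        using lipschitz_onD [OF P that] \<open>n > 0\<close> by (simp add: dist_norm)
      finally show "spectral_norm ?D \<le> n * (C * dist x y)" .
    qed simp
    finally show ?thesis
      by (simp add: matrix_vector_mult_diff_rdistrib inner_diff_right mult.assoc)
  qed
  obtain l where "l > 0" and l: "\<And>w. l * norm w \<le> norm (facP L \<Lambda>\<^sub>0 *v w)"
    using linear_inj_bounded_below_pos [OF matrix_vector_mul_linear
        inj_matrix_vector_mult [OF facP_invertible [OF L \<open>\<Lambda>\<^sub>0 \<in> feasible L\<close>]]] by blast
  \<comment> \<open>a radius on which the form of \<open>P\<close> loses at most half of its lower bound \<open>l\<^sup>2\<close> at \<open>\<Lambda>\<^sub>0\<close>\<close>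
  define v where "v = min u (l\<^sup>2 / (2 * (n * C + 1)))"
  have "v > 0"
    using \<open>u > 0\<close> \<open>l > 0\<close> \<open>n > 0\<close> \<open>C \<ge> 0\<close> by (simp add: v_def add_nonneg_pos)
  have below: "l\<^sup>2 / 2 * (norm w)\<^sup>2 \<le> (norm (facP L y *v w))\<^sup>2"
    if y: "y \<in> cball \<Lambda>\<^sub>0 v \<inter> feasible L" for y and w :: "real^'N"
  proof -
    have "n * C * dist \<Lambda>\<^sub>0 y \<le> (n * C + 1) * (l\<^sup>2 / (2 * (n * C + 1)))"
      using y \<open>n > 0\<close> \<open>C \<ge> 0\<close> by (intro mult_mono) (auto simp: v_def)
    also have "\<dots> = l\<^sup>2 / 2"
    proof -
      have "n * C + 1 > 0"
        using \<open>n > 0\<close> \<open>C \<ge> 0\<close> by (simp add: add_nonneg_pos)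
      then show ?thesis
        by (simp add: divide_simps)
    qed
    finally have small: "n * C * dist \<Lambda>\<^sub>0 y * (norm w)\<^sup>2 \<le> l\<^sup>2 / 2 * (norm w)\<^sup>2"
      by (rule mult_right_mono) simp
    have "l\<^sup>2 * (norm w)\<^sup>2 \<le> (norm (facP L \<Lambda>\<^sub>0 *v w))\<^sup>2"
      using power_mono [OF l, of w 2] \<open>l > 0\<close> by (simp add: power_mult_distrib)
    also have "\<dots> \<le> (norm (facP L y *v w))\<^sup>2 + n * C * dist \<Lambda>\<^sub>0 y * (norm w)\<^sup>2"
      using diff [of \<Lambda>\<^sub>0 y w] y assms by (simp add: lyap_P_quadratic_form v_def)
    finally show ?thesis
      using small by simp
  qed
  define b where "b = n * C * (2 / l\<^sup>2)"
  have "b \<ge> 0"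
    using \<open>n > 0\<close> \<open>C \<ge> 0\<close> by (simp add: b_def)
  show ?thesis
  proof (rule that [OF \<open>v > 0\<close> _ \<open>b \<ge> 0\<close>])
    fix x y w
    assume x: "x \<in> cball \<Lambda>\<^sub>0 v \<inter> feasible L" and y: "y \<in> cball \<Lambda>\<^sub>0 v \<inter> feasible L"
    show "norm (facP L x *v w) \<le> (1 + b * dist x y) * norm (facP L y *v w)"
    proof (rule power2_le_imp_le)
      have "(norm (facP L x *v w))\<^sup>2 \<le> (norm (facP L y *v w))\<^sup>2 + n * C * dist x y * (norm w)\<^sup>2"
        using diff [of x y w] x y L by (simp add: lyap_P_quadratic_form v_def)
      also have "\<dots> \<le> (norm (facP L y *v w))\<^sup>2 + n * C * dist x y * (2 / l\<^sup>2 * (norm (facP L y *v w))\<^sup>2)"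
        using below [OF y, of w] \<open>n > 0\<close> \<open>C \<ge> 0\<close> \<open>l > 0\<close>
        by (intro add_left_mono mult_left_mono) (auto simp: field_simps)
      also have "\<dots> = (1 + b * dist x y) * (norm (facP L y *v w))\<^sup>2"
        by (simp add: b_def algebra_simps)
      also have "\<dots> \<le> (1 + b * dist x y)\<^sup>2 * (norm (facP L y *v w))\<^sup>2"
        using \<open>b \<ge> 0\<close> by (intro mult_right_mono self_le_power) auto
      finally show "(norm (facP L x *v w))\<^sup>2 \<le> ((1 + b * dist x y) * norm (facP L y *v w))\<^sup>2"
        by (simp add: power_mult_distrib)
    qed (use \<open>b \<ge> 0\<close> in simp)
  qed (simp add: v_def)
qed

section \<open>The value function\<close>

lemma spectral_norm_J_mat: "spectral_norm (J_mat L \<Lambda> \<mu>) = factor_norm (facP L \<Lambda>) (G_mat L \<Lambda> \<mu>)"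
  by (simp add: J_mat_def factor_norm_def)

lemma J_mat_eq_0_imp_G_mat_eq_0:
  fixes L :: "('n::finite, 'N::finite) lift_data"
  assumes "factor_spec L" "\<Lambda> \<in> feasible L" "J_mat L \<Lambda> \<mu> = 0"
  shows "G_mat L \<Lambda> \<mu> = 0"
proof -
  obtain c where c: "c > 0" "\<And>X :: real^'N^('N \<times> 'N). c * norm X \<le> factor_norm (facP L \<Lambda>) X"
    using factor_norm_lower [OF facP_invertible [OF assms(1,2)]] by blast
  have "factor_norm (facP L \<Lambda>) (G_mat L \<Lambda> \<mu>) = 0"
    unfolding spectral_norm_J_mat [symmetric] by (simp add: assms(3) spectral_norm_eq_0)
  then show ?thesis
    using c(1) c(2) [of "G_mat L \<Lambda> \<mu>"] by (simp add: mult_le_0_iff)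
qed

text \<open>
  The base point \<open>g(\<Lambda>)\<close> of the translate of \<^const>\<open>gauge_image\<close>.
\<close>

definition ungauged_G :: "('n::finite, 'N::finite) lift_data \<Rightarrow> real^'N \<Rightarrow> real^'N^('N \<times> 'N)" where
  "ungauged_G L \<Lambda> = stacked_lyapunov (lyap_P L \<Lambda>) (H_stab L \<Lambda>)"

text \<open>
  The gauge matrix \<open>K\<close> moves \<open>G\<close> by \<open>G(P, K) = G(I, P K)\<close>; every \<open>S\<close> in the gauge space is of the form
  \<open>P K\<close>, with \<open>K = P\<^sup>-\<^sup>1 S\<close>.
\<close>

lemma range_G_mat:
  fixes L :: "('n::finite, 'N::finite) lift_data"
  assumes "factor_spec L" "gauge_basis L" "\<Lambda> \<in> feasible L"
  shows "G_mat L \<Lambda> ` gauge_params L = (+) (ungauged_G L \<Lambda>) ` gauge_image"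
proof -
  interpret bounded_bilinear stacked_lyapunov
    by (rule bounded_bilinear_stacked_lyapunov)
  let ?P = "lyap_P L \<Lambda>"
  let ?K = "\<lambda>\<mu>. \<Sum>k=1..gauge_dim L. \<mu> k *\<^sub>R Kbasis L k"
  have G: "G_mat L \<Lambda> \<mu> = ungauged_G L \<Lambda> + stacked_lyapunov (mat 1) (?P ** ?K \<mu>)" for \<mu>
    by (simp add: G_mat_eq H_gauge_def ungauged_G_def add_right
        stacked_lyapunov_symmetric [OF lyap_P_symmetric [OF assms(1,3)], symmetric])
  show ?thesis
  proof (intro equalityI image_subsetI)
    fix \<mu>
    have "?P ** ?K \<mu> \<in> gauge_space"
      by (intro gauge_space_mult gauge_params_sum_in_gauge_space assms)
    then show "G_mat L \<Lambda> \<mu> \<in> (+) (ungauged_G L \<Lambda>) ` gauge_image"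
      unfolding G gauge_image_def by blast
  next
    fix U :: "real^'N^('N \<times> 'N)"
    assume "U \<in> gauge_image"
    then obtain S where S: "S \<in> gauge_space" "U = stacked_lyapunov (mat 1) S"
      unfolding gauge_image_def by blast
    have "invertible ?P"
      using facP_invertible [OF assms(1,3)]
      by (simp add: lyap_P_factor [OF assms(1,3)] invertible_det_nz det_mul)
    obtain \<mu> where \<mu>: "\<mu> \<in> gauge_params L" "matrix_inv ?P ** S = ?K \<mu>"
      using gauge_params_represent [OF assms(2) gauge_space_mult [OF S(1)]] by blast
    have "?P ** ?K \<mu> = S"
      unfolding \<mu>(2) [symmetric] by (simp add: matrix_mul_assoc matrix_inv_right \<open>invertible ?P\<close>)
    then have "ungauged_G L \<Lambda> + U = G_mat L \<Lambda> \<mu>"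
      by (simp add: G S(2))
    then show "ungauged_G L \<Lambda> + U \<in> G_mat L \<Lambda> ` gauge_params L"
      using \<mu>(1) by blast
  qed
qed

lemma phi_attained:
  fixes L :: "('n::finite, 'N::finite) lift_data"
  assumes "factor_spec L" "gauge_basis L" "\<Lambda> \<in> feasible L"
  obtains U where "U \<in> gauge_image" "phi L \<Lambda> = factor_norm (facP L \<Lambda>) (ungauged_G L \<Lambda> + U)"
    "\<And>V. V \<in> gauge_image \<Longrightarrow> phi L \<Lambda> \<le> factor_norm (facP L \<Lambda>) (ungauged_G L \<Lambda> + V)"
proof -
  let ?f = "factor_norm (facP L \<Lambda>) :: real^'N^('N \<times> 'N) \<Rightarrow> real"
  obtain c where c: "c > 0" "\<And>X. c * norm X \<le> ?f X"
    using factor_norm_lower [OF facP_invertible [OF assms(1,3)]] by blast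
  have "closed (gauge_image :: (real^'N^('N \<times> 'N)) set)" "gauge_image \<noteq> ({} :: (real^'N^('N \<times> 'N)) set)"
    using subspace_gauge_image subspace_0 by (auto intro: closed_subspace)
  then obtain U where U: "U \<in> gauge_image"
      "\<And>V. V \<in> gauge_image \<Longrightarrow> ?f (ungauged_G L \<Lambda> + U) \<le> ?f (ungauged_G L \<Lambda> + V)"
    using attains_min_on_translate [OF _ _ continuous_on_factor_norm c] by blast
  have "phi L \<Lambda> = Inf (?f ` G_mat L \<Lambda> ` gauge_params L)"
    by (simp add: phi_def spectral_norm_J_mat image_image)
  also have "\<dots> = ?f (ungauged_G L \<Lambda> + U)"
    unfolding range_G_mat [OF assms] by (rule cInf_eq_minimum) (use U in auto)
  finally show ?thesis
    using U by (intro that) auto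
qed

lemma phi_attained_gauge_params:
  fixes L :: "('n::finite, 'N::finite) lift_data"
  assumes "factor_spec L" "gauge_basis L" "\<Lambda> \<in> feasible L"
  shows "\<exists>\<mu>\<in>gauge_params L. spectral_norm (J_mat L \<Lambda> \<mu>) = phi L \<Lambda> \<and>
           (\<forall>\<mu>'\<in>gauge_params L. phi L \<Lambda> \<le> spectral_norm (J_mat L \<Lambda> \<mu>'))"
proof -
  obtain U where U: "U \<in> gauge_image" "phi L \<Lambda> = factor_norm (facP L \<Lambda>) (ungauged_G L \<Lambda> + U)"
    and le: "\<And>V. V \<in> gauge_image \<Longrightarrow> phi L \<Lambda> \<le> factor_norm (facP L \<Lambda>) (ungauged_G L \<Lambda> + V)"
    using phi_attained [OF assms] by blast
  have "ungauged_G L \<Lambda> + U \<in> G_mat L \<Lambda> ` gauge_params L"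
    unfolding range_G_mat [OF assms] using U(1) by blast
  then obtain \<mu> where "\<mu> \<in> gauge_params L" "G_mat L \<Lambda> \<mu> = ungauged_G L \<Lambda> + U"
    by (metis imageE)
  moreover have "phi L \<Lambda> \<le> spectral_norm (J_mat L \<Lambda> \<mu>')" if "\<mu>' \<in> gauge_params L" for \<mu>'
  proof -
    have "G_mat L \<Lambda> \<mu>' \<in> (+) (ungauged_G L \<Lambda>) ` gauge_image"
      unfolding range_G_mat [OF assms, symmetric] using that by blast
    then show ?thesis
      using le by (auto simp: spectral_norm_J_mat)
  qed
  ultimately show ?thesis
    using U(2) by (metis spectral_norm_J_mat)
qed

lemma phi_locally_lipschitz:
  fixes L :: "('n::finite, 'N::finite) lift_data"
  assumes L: "factor_spec L" "gauge_basis L"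
  shows "locally_lipschitz_on (feasible L) (phi L)"
  unfolding locally_lipschitz_on_def
proof
  fix \<Lambda>\<^sub>0 assume \<Lambda>\<^sub>0: "\<Lambda>\<^sub>0 \<in> feasible L"
  obtain u C where "u > 0" and P: "C-lipschitz_on (cball \<Lambda>\<^sub>0 u \<inter> feasible L) (lyap_P L)"
    using lyap_P_locally_lipschitz [OF \<Lambda>\<^sub>0] by blast
  obtain v b where v: "0 < v" "v \<le> u" and "b \<ge> 0"
    and F: "\<And>x y w. \<lbrakk>x \<in> cball \<Lambda>\<^sub>0 v \<inter> feasible L; y \<in> cball \<Lambda>\<^sub>0 v \<inter> feasible L\<rbrakk> \<Longrightarrow>
       norm (facP L x *v w) \<le> (1 + b * dist x y) * norm (facP L y *v w)"
    using facP_comparison [OF L(1) \<Lambda>\<^sub>0 P \<open>u > 0\<close>] by blast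
  define S where "S = cball \<Lambda>\<^sub>0 v \<inter> feasible L"
  have "\<Lambda>\<^sub>0 \<in> S"
    using \<Lambda>\<^sub>0 v by (simp add: S_def)
  have "bounded S"
    unfolding S_def by (rule bounded_subset [OF bounded_cball]) auto
  let ?nu = "\<lambda>x. factor_norm (facP L x) :: real^'N^('N \<times> 'N) \<Rightarrow> real"
  have compare: "?nu y X \<le> (1 + b * dist x y) * ?nu x X" if "x \<in> S" "y \<in> S" for x y X
    using that F [of x y] \<open>b \<ge> 0\<close> by (intro factor_norm_mono facP_invertible L) (auto simp: S_def)
  obtain D where D: "D \<ge> 0" "\<And>X. ?nu \<Lambda>\<^sub>0 X \<le> D * norm X"
    using factor_norm_upper [where F = "facP L \<Lambda>\<^sub>0" and 'k = 'N and 's = 'N] by blast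
  have upper: "?nu x X \<le> (1 + b * v) * D * norm X" if "x \<in> S" for x X
  proof -
    have "?nu x X \<le> (1 + b * dist \<Lambda>\<^sub>0 x) * ?nu \<Lambda>\<^sub>0 X"
      by (rule compare [OF \<open>\<Lambda>\<^sub>0 \<in> S\<close> that])
    also have "\<dots> \<le> (1 + b * v) * (D * norm X)"
      using that D \<open>b \<ge> 0\<close> v by (intro mult_mono add_left_mono mult_left_mono) (auto simp: S_def)
    finally show ?thesis
      by simp
  qed
  obtain H where "H-lipschitz_on UNIV (H_stab L)"
    using H_stab_lipschitz by blast
  then have H: "H-lipschitz_on S (H_stab L)"
    by (rule lipschitz_on_subset) simp
  have P': "C-lipschitz_on S (lyap_P L)"
    using P by (rule lipschitz_on_subset) (use v in \<open>auto simp: S_def\<close>)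
  obtain E where E: "E-lipschitz_on S (ungauged_G L)"
    using bounded_bilinear_lipschitz_on [OF bounded_bilinear_stacked_lyapunov P' _ H]
      lipschitz_on_bounded_image [OF P' \<open>bounded S\<close>] lipschitz_on_bounded_image [OF H \<open>bounded S\<close>]
    unfolding ungauged_G_def by blast
  obtain M where M: "M > 0" "\<And>x. x \<in> S \<Longrightarrow> norm (ungauged_G L x) \<le> M"
    using lipschitz_on_bounded_image [OF E \<open>bounded S\<close>] unfolding bounded_pos by auto
  have "(b * ((1 + b * v) * D * M) + (1 + b * v) * D * E)-lipschitz_on S (phi L)"
  proof (rule min_over_translate_lipschitz [where \<nu> = ?nu and W = gauge_image])
    fix x assume "x \<in> S"
    then have "x \<in> feasible L"
      by (simp add: S_def)
    then show "\<exists>u\<in>gauge_image. phi L x = ?nu x (ungauged_G L x + u)"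
      using phi_attained [OF L] by blast
    show "phi L x \<le> ?nu x (ungauged_G L x + u)" if "u \<in> gauge_image" for u
      using phi_attained [OF L \<open>x \<in> feasible L\<close>] that by blast
  next
    show "0 \<in> (gauge_image :: (real^'N^('N \<times> 'N)) set)"
      by (rule subspace_0 [OF subspace_gauge_image])
  qed (use E M D v \<open>b \<ge> 0\<close> compare upper factor_norm_triangle in auto)
  then show "\<exists>u>0. \<exists>K. K-lipschitz_on (cball \<Lambda>\<^sub>0 u \<inter> feasible L) (phi L)"
    using v unfolding S_def by blast
qed

lemma locally_lipschitz_on_imp_continuous_on:
  assumes "locally_lipschitz_on X f"
  shows "continuous_on X f"
  unfolding continuous_on_eq_continuous_within
proof
  fix x assume "x \<in> X"
  then obtain u C where "u > 0" and C: "C-lipschitz_on (cball x u \<inter> X) f"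
    using assms unfolding locally_lipschitz_on_def by blast
  have "continuous (at x within cball x u \<inter> X) f"
    using lipschitz_on_continuous_on [OF C] \<open>x \<in> X\<close> \<open>u > 0\<close>
    by (simp add: continuous_on_eq_continuous_within)
  moreover have "at x within cball x u \<inter> X = at x within X"
    by (rule at_within_nhd [of x "ball x u"]) (use \<open>u > 0\<close> in auto)
  ultimately show "continuous (at x within X) f"
    by simp
qed

section \<open>The Lyapunov function for a vanishing certificate\<close>

lemma outer_mult_vec: "outer u v *v w = (v \<bullet> w) *\<^sub>R u"
  by (simp add: vec_eq_iff outer_def matrix_vector_mult_def inner_vec_def sum_distrib_left mult_ac)

lemma sum_matrix_mult_vec: "sum f S *v w = (\<Sum>i\<in>S. f i *v w)"
  by (induction S rule: infinite_finite_induct) (simp_all add: matrix_vector_mult_add_rdistrib)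

lemma F_stab_eq:
  assumes "svec_spec L"
  shows "F_stab L \<Lambda> w = A_stab L \<Lambda> *v w + H_stab L \<Lambda> *v kron_vec w w"
proof -
  have A: "A_stab L \<Lambda> *v w = A0 L *v w - (\<Sum>i=1..mlift L. (\<Lambda> $ ypos L i * w $ ypos L i) *\<^sub>R axis (ypos L i) 1)"
    by (simp add: A_stab_def matrix_vector_mult_diff_rdistrib sum_matrix_mult_vec
        scaleR_matrix_vector_assoc [symmetric] outer_mult_vec inner_axis')
  have "H_stab L \<Lambda> *v kron_vec w w = H0 L *v kron_vec w w
      + (\<Sum>i=1..mlift L. (\<Lambda> $ ypos L i * (svec L i \<bullet> kron_vec w w)) *\<^sub>R axis (ypos L i) 1)"
    by (simp add: H_stab_def matrix_vector_mult_add_rdistrib sum_matrix_mult_vec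
        scaleR_matrix_vector_assoc [symmetric] outer_mult_vec)
  also have "\<dots> = H0 L *v kron_vec w w
      + (\<Sum>i=1..mlift L. (\<Lambda> $ ypos L i * (w $ fac_a L i * w $ fac_b L i)) *\<^sub>R axis (ypos L i) 1)"
    using assms by (simp add: svec_spec_def)
  finally have H: "H_stab L \<Lambda> *v kron_vec w w = H0 L *v kron_vec w w
      + (\<Sum>i=1..mlift L. (\<Lambda> $ ypos L i * (w $ fac_a L i * w $ fac_b L i)) *\<^sub>R axis (ypos L i) 1)" .
  show ?thesis
    by (simp add: A H F_stab_def F0_def stabilizer_def right_diff_distrib scaleR_left_diff_distrib sum_subtractf)
qed

lemma mult_kron_vec: "H *v kron_vec u w = (\<Sum>i\<in>UNIV. u $ i *\<^sub>R (H_block H i *v w))"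
  by (simp add: vec_eq_iff matrix_vector_mult_def kron_vec_def H_block_def sum_UNIV_prod
      sum_distrib_left mult_ac)

lemma orbital_deriv_quad_form:
  assumes "transpose P = P"
  shows "orbital_deriv (quad_form P) F w = 2 * (w \<bullet> (P *v F w))"
proof -
  have "(quad_form P has_derivative (\<lambda>h. w \<bullet> (P *v h) + h \<bullet> (P *v w))) (at w)"
    unfolding quad_form_def
    by (intro has_derivative_inner has_derivative_ident bounded_linear.has_derivative [OF matrix_vector_mul_bounded_linear])
  then have "frechet_derivative (quad_form P) (at w) = (\<lambda>h. w \<bullet> (P *v h) + h \<bullet> (P *v w))"
    by (rule frechet_derivative_at [symmetric])
  moreover have "h \<bullet> (P *v w) = w \<bullet> (P *v h)" for h
    by (metis assms dot_lmul_matrix inner_commute transpose_matrix_vector)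
  ultimately show ?thesis
    by (simp add: orbital_deriv_def)
qed

text \<open>
  The gauge does not change the vector field, so \<open>H(\<Lambda>, \<mu>)\<close> can replace \<open>H(\<Lambda>)\<close>.  Its value at
  \<open>w \<otimes> w\<close> is \<open>\<Sum>\<^sub>i w\<^sub>i M\<^sub>i w\<close>, and \<open>2 w\<^sup>T P M\<^sub>i w = w\<^sup>T (M\<^sub>i\<^sup>T P + P M\<^sub>i) w = 0\<close>.
\<close>

lemma global_lyapunov_if_J_mat_eq_0:
  fixes L :: "('n::finite, 'N::finite) lift_data"
  assumes "factor_spec L" "gauge_basis L" "svec_spec L" "\<Lambda> \<in> feasible L" and J: "J_mat L \<Lambda> \<mu> = 0"
  shows "global_lyapunov (lyap_P L \<Lambda>) (F_stab L \<Lambda>)"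
  unfolding global_lyapunov_def
proof (intro conjI allI impI)
  let ?P = "lyap_P L \<Lambda>"
  let ?M = "H_block (H_gauge L \<Lambda> \<mu>)"
  have sym: "transpose ?P = ?P"
    using assms by (simp add: lyap_P_symmetric)
  show "pos_def ?P"
    using assms by (simp add: lyap_P_pos_def)
  fix w :: "real^'N" assume "w \<noteq> 0"
  have "lyapunov_op (?M i) ?P = 0" for i
    using J_mat_eq_0_imp_G_mat_eq_0 [OF assms(1,4) J] by (simp add: G_mat_eq stacked_lyapunov_eq_0_iff)
  then have M: "w \<bullet> (?P *v (?M i *v w)) = 0" for i
    using symmetric_lyapunov_form [OF sym, of w "?M i"] by simp
  have "H_stab L \<Lambda> *v kron_vec w w = H_gauge L \<Lambda> \<mu> *v kron_vec w w"
    using gauge_params_sum_in_gauge_space [OF assms(2), of \<mu>]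
    by (simp add: H_gauge_def matrix_vector_mult_add_rdistrib gauge_space_def)
  then have "w \<bullet> (?P *v (H_stab L \<Lambda> *v kron_vec w w)) = 0"
    by (simp add: mult_kron_vec M matrix_vector_mult_scaleR inner_sum_right linear_sum [OF matrix_vector_mul_linear])
  then have "orbital_deriv (quad_form ?P) (F_stab L \<Lambda>) w = - (norm w)\<^sup>2"
    using lyap_P_decay [OF assms(1,4), of w]
    by (simp add: orbital_deriv_quad_form [OF sym] F_stab_eq assms(3) matrix_vector_right_distrib inner_add_right)
  then show "orbital_deriv (quad_form ?P) (F_stab L \<Lambda>) w < 0"
    using \<open>w \<noteq> 0\<close> by simp
qed

section \<open>Gain optimisation over a box\<close>

theorem proposition3p10:
  fixes p :: "real^'n::finite \<Rightarrow> real^'n"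
    and L :: "('n, 'N::finite) lift_data"
  assumes "polynomial_function p" and "p 0 = 0"
    and "hurwitz (jacobian p (at 0))"
    and "inner_quadratic_lift L"
    and "reference_extension p L"
    and "svec_spec L"
    and "gauge_basis L"
    and "factor_spec L"
  shows "(\<forall>\<Lambda>\<in>feasible L. \<exists>\<mu>\<in>gauge_params L.
            spectral_norm (J_mat L \<Lambda> \<mu>) = phi L \<Lambda> \<and>
            (\<forall>\<mu>'\<in>gauge_params L. phi L \<Lambda> \<le> spectral_norm (J_mat L \<Lambda> \<mu>')))
       \<and> locally_lipschitz_on (feasible L) (phi L)
       \<and> (\<forall>B. admissible_box L B \<longrightarrow>
            (\<exists>\<Lambda>\<in>B. phi L \<Lambda> = phi_box L B \<and> (\<forall>\<Lambda>'\<in>B. phi_box L B \<le> phi L \<Lambda>'))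
          \<and> (phi_box L B > 0 \<longrightarrow>
               (\<exists>\<Lambda>. is_arg_max (rho_star L) (\<lambda>\<Lambda>. \<Lambda> \<in> B) \<Lambda>)
             \<and> (\<forall>\<Lambda>. is_arg_max (rho_star L) (\<lambda>\<Lambda>. \<Lambda> \<in> B) \<Lambda>
                    \<longleftrightarrow> is_arg_min (phi L) (\<lambda>\<Lambda>. \<Lambda> \<in> B) \<Lambda>))
          \<and> (phi_box L B = 0 \<longrightarrow>
               (\<forall>\<Lambda>\<in>B. \<forall>\<mu>\<in>gauge_params L.
                  spectral_norm (J_mat L \<Lambda> \<mu>) = phi_box L B \<longrightarrow>
                  J_mat L \<Lambda> \<mu> = 0 \<and> global_lyapunov (lyap_P L \<Lambda>) (F_stab L \<Lambda>))))"
proof (intro conjI allI impI ballI)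
  note L = \<open>factor_spec L\<close> \<open>gauge_basis L\<close>
  show lip: "locally_lipschitz_on (feasible L) (phi L)"
    by (rule phi_locally_lipschitz [OF L])
  show "\<exists>\<mu>\<in>gauge_params L. spectral_norm (J_mat L \<Lambda> \<mu>) = phi L \<Lambda> \<and>
      (\<forall>\<mu>'\<in>gauge_params L. phi L \<Lambda> \<le> spectral_norm (J_mat L \<Lambda> \<mu>'))" if "\<Lambda> \<in> feasible L" for \<Lambda>
    by (rule phi_attained_gauge_params [OF L that])
  fix B assume B: "admissible_box L B"
  have "compact B" "B \<noteq> {}" "B \<subseteq> feasible L"
    using B by (auto simp: admissible_box_def)
  moreover have "continuous_on B (phi L)"
    using continuous_on_subset [OF locally_lipschitz_on_imp_continuous_on [OF lip] \<open>B \<subseteq> feasible L\<close>] .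
  ultimately obtain \<Lambda>\<^sub>m where m: "\<Lambda>\<^sub>m \<in> B" "\<And>\<Lambda>. \<Lambda> \<in> B \<Longrightarrow> phi L \<Lambda>\<^sub>m \<le> phi L \<Lambda>"
    using continuous_attains_inf by metis
  have box: "phi_box L B = phi L \<Lambda>\<^sub>m"
    unfolding phi_box_def by (rule cInf_eq_minimum) (use m in auto)
  show "\<exists>\<Lambda>\<in>B. phi L \<Lambda> = phi_box L B \<and> (\<forall>\<Lambda>'\<in>B. phi_box L B \<le> phi L \<Lambda>')"
    using m box by auto
  have arg: "is_arg_max (rho_star L) (\<lambda>\<Lambda>. \<Lambda> \<in> B) \<Lambda> \<longleftrightarrow> is_arg_min (phi L) (\<lambda>\<Lambda>. \<Lambda> \<in> B) \<Lambda>"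
    if pos: "phi_box L B > 0" for \<Lambda>
  proof -
    have phi_pos: "phi L \<Lambda>' > 0" if "\<Lambda>' \<in> B" for \<Lambda>'
      using pos m(2) [OF that] by (simp add: box)
    \<comment> \<open>on positive values, \<open>t \<mapsto> 1 / t\<close> is finite and strictly decreasing\<close>
    have "rho_star L \<Lambda>1 < rho_star L \<Lambda>2 \<longleftrightarrow> phi L \<Lambda>2 < phi L \<Lambda>1" if "\<Lambda>1 \<in> B" "\<Lambda>2 \<in> B" for \<Lambda>1 \<Lambda>2
      using phi_pos that by (force simp: rho_star_def one_ereal_def field_simps)
    then show ?thesis
      by (auto simp: is_arg_max_def is_arg_min_def)
  qed
  show "\<exists>\<Lambda>. is_arg_max (rho_star L) (\<lambda>\<Lambda>. \<Lambda> \<in> B) \<Lambda>" if "phi_box L B > 0"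
    unfolding arg [OF that] using m by (auto simp: is_arg_min_linorder)
  show "is_arg_max (rho_star L) (\<lambda>\<Lambda>. \<Lambda> \<in> B) \<Lambda> \<longleftrightarrow> is_arg_min (phi L) (\<lambda>\<Lambda>. \<Lambda> \<in> B) \<Lambda>"
    if "phi_box L B > 0" for \<Lambda>
    by (rule arg [OF that])
  fix \<Lambda> \<mu>
  assume "phi_box L B = 0" "\<Lambda> \<in> B" "spectral_norm (J_mat L \<Lambda> \<mu>) = phi_box L B"
  then show J: "J_mat L \<Lambda> \<mu> = 0"
    by (simp add: spectral_norm_eq_0)
  show "global_lyapunov (lyap_P L \<Lambda>) (F_stab L \<Lambda>)"
    using assms J \<open>\<Lambda> \<in> B\<close> \<open>B \<subseteq> feasible L\<close> by (intro global_lyapunov_if_J_mat_eq_0) auto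
qed

end
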